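(* Assume that: (i) $K$ is a bounded nonnegative function on $\mathbb{R}^d$ with $\int_{\mathbb{R}^d}K(z)\,dz=1$, $\int_{\mathbb{R}^d}z_jK(z)\,dz=0$ for all $j\in\{1,\dots,d\}$, and $\int_{\mathbb{R}^d}\|z\|^2|K(z)|\,dz<\infty$; (ii) $K$ is Hölder-continuous on $\mathbb{R}^d$ and satisfies the covering number condition; (iii) $f$ is twice differentiable on $\mathbb{R}^d$, $\sup_{x\in\mathbb{R}^d}\|\nabla f(x)\|<\infty$ and $\sup_{x\in\mathbb{R}^d}\|D^2f(x)\|<\infty$; (iv) there exists $q>0$ such that $z\mapsto\|z\|^qf(z)$ is a bounded function on $\mathbb{R}^d$. Let $(\epsilon_n)$ be a sequence of positive real numbers and assume that $$\epsilon_n\to 0,\quad \frac{h_n^*}{\epsilon_n}\to 0,\quad \frac{h_n^2}{\epsilon_n}\to 0,\quad v_n\epsilon_n^{3/2}\to\infty,\quad \frac{v_nh_n^{*2}}{\sqrt{\epsilon_n}}\to 0,\quad \frac{nh_n^{*d}}{v_n^2\log(1/h_n^* )}\to\infty,\quad \frac{v_n^2h_n^d\epsilon_n^2}{h_n^{*d}}\to\infty .$$ Let $\tilde T_n(x)=f_n(x)$ if $f_n(x)\geq\epsilon_n$ and $\tilde T_n(x)=\epsilon_n$ otherwise. Then, for any $\delta>0$, $$\lim_{n\to\infty}\frac{v_n^2}{nh_n^{*d}}\log\mathbb{P}\left(\exists x\in\mathbb{R}^d,\ f(x)\notin\left[f_n^*(x)-\delta\frac{\sqrt{\tilde T_n(x)\kappa}}{v_n}\,;\,f_n^*(x)+\delta\frac{\sqrt{\tilde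 T_n(x)\kappa}}{v_n}\right]\right)=-\frac{\delta^2}{2}.$$ Moreover, the sequence of sets of functions $$D_n=\left\{g:\mathbb{R}^d\to\mathbb{R},\ |g(x)-f_n^*(x)|\leq\delta\frac{\sqrt{\tilde T_n(x)\kappa}}{v_n}\ \ \forall x\in\mathbb{R}^d\right\}$$ is an asymptotic almost sure sequence of confidence regions of $f$.
   Context: Setting: $d\geq 1$ is an integer and $X_1,X_2,\dots$ are independent identically distributed $\mathbb{R}^d$-valued random vectors, defined on a probability space $(\Omega,\mathcal{A},\mathbb{P})$, with bounded probability density $f$. The kernel $K$ is a bounded nonnegative function on $\mathbb{R}^d$ with $\int K=1$ and $\lim_{\|z\|\to\infty}K(z)=0$. $(h_n)$ and $(h_n^* )$ are sequences of positive real numbers with $h_n\to 0$, $h_n^*\to 0$. $(v_n)$ is a positive nonrandom sequence with $v_n\to\infty$. The kernel density estimators are $$f_n(x)=\frac{1}{nh_n^d}\sum_{j=1}^nK\left(\frac{x-X_j}{h_n}\right),\qquad f_n^*(x)=\frac{1}{nh_n^{*d}}\sum_{j=1}^nK\left(\frac{x-X_j}{h_n^*}\right),$$ and $\kappa=\int_{\mathbb{R}^d}K^2(z)\,dz$. Covering number condition: for a probability $Q$ on $\mathbb{R}^d$ and a class $\mathcal{F}\subset\mathcal{L}_2(Q)$, the covering number $N_2(\epsilon,Q,\mathcal{F})$ is the smallest $m$ for which there exist $g_1,\dots,g_m\in\mathcal{L}_2(Q)$ with $\min_{1\leq i\leq m}\|g-g_i\|_{\mathcal{L}_2(Q)}\leq\epsilon$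 for all $g\in\mathcal{F}$ ($N_2=\infty$ if no such $m$ exists). For a bounded integrable function $\Lambda$ on $\mathbb{R}^d$ let $\mathcal{F}(\Lambda)=\{z\mapsto\Lambda(\frac{x-z}{h}):\ h>0,\ x\in\mathbb{R}^d\}$. $\Lambda$ satisfies the covering number condition if there exist $A>0$ and $v>0$ such that, for any probability $Q$ on $\mathbb{R}^d$ and any $\epsilon\in(0,1)$, $N_2(\epsilon\|\Lambda\|_\infty,Q,\mathcal{F}(\Lambda))\leq(A/\epsilon)^v$. A sequence $(D_n)$ of (random) confidence regions of an unknown parameter $\theta$ is an asymptotic almost sure sequence of confidence regions of $\theta$ if there exists $\Omega_0\subset\Omega$ with $\mathbb{P}(\Omega_0)=1$ such that for every $\omega\in\Omega_0$ there is $N(\omega)$ such that $n\geq N(\omega)$ implies $\theta\in D_n(\omega)$. *)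

theory Defs
  imports "HOL-Probability.Probability"
begin

definition kde :: "(real^'d \<Rightarrow> real) \<Rightarrow> (nat \<Rightarrow> 'w \<Rightarrow> real^'d) \<Rightarrow> nat \<Rightarrow> real \<Rightarrow> 'w \<Rightarrow> real^'d \<Rightarrow> real" where
  "kde K X n h \<omega> x = (1 / (real n * h ^ CARD('d))) * (\<Sum>j=1..n. K ((x - X j \<omega>) /\<^sub>R h))"

definition trunc_kde :: "(real^'d \<Rightarrow> real) \<Rightarrow> (nat \<Rightarrow> 'w \<Rightarrow> real^'d) \<Rightarrow> nat \<Rightarrow> real \<Rightarrow> real \<Rightarrow> 'w \<Rightarrow> real^'d \<Rightarrow> real" where
  "trunc_kde K X n h e \<omega> x = (if kde K X n h \<omega> x \<ge> e then kde K X n h \<omega> x else e)"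

definition kappa :: "(real^'d \<Rightarrow> real) \<Rightarrow> real" where
  "kappa K = (\<integral>z. (K z)\<^sup>2 \<partial>lborel)"

definition holder_continuous :: "('a::real_normed_vector \<Rightarrow> real) \<Rightarrow> bool" where
  "holder_continuous g \<longleftrightarrow>
     (\<exists>\<alpha> C. 0 < \<alpha> \<and> \<alpha> \<le> 1 \<and> (\<forall>x y. \<bar>g x - g y\<bar> \<le> C * norm (x - y) powr \<alpha>))"

definition L2_space :: "'a measure \<Rightarrow> ('a \<Rightarrow> real) set" where
  "L2_space Q = {g. g \<in> borel_measurable Q \<and> integrable Q (\<lambda>z. (g z)\<^sup>2)}"

definition L2_dist :: "'a measure \<Rightarrow> ('a \<Rightarrow> real) \<Rightarrow> ('a \<Rightarrow> real) \<Rightarrow> real" where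
  "L2_dist Q g g' = sqrt (\<integral>z. (g z - g' z)\<^sup>2 \<partial>Q)"

(* The infimum of the empty set in enat is \<infinity>.  L2_dist is meaningful only on L2_space Q,
   so this is intended for classes F contained in L2_space Q. *)
definition covering_number :: "real \<Rightarrow> 'a measure \<Rightarrow> ('a \<Rightarrow> real) set \<Rightarrow> enat" where
  "covering_number e Q F =
     Inf {enat m | m. \<exists>g :: nat \<Rightarrow> 'a \<Rightarrow> real.
            (\<forall>i\<in>{1..m}. g i \<in> L2_space Q) \<and> (\<forall>\<phi>\<in>F. \<exists>i\<in>{1..m}. L2_dist Q \<phi> (g i) \<le> e)}"

definition kernel_class :: "('a::real_normed_vector \<Rightarrow> real) \<Rightarrow> ('a \<Rightarrow> real) set" where
  "kernel_class \<Lambda> = {(\<lambda>z. \<Lambda> ((x - z) /\<^sub>R h)) | h x. h > 0}"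

(* Intended for bounded integrable \<Lambda>: the supremum is then finite and
   kernel_class \<Lambda> is contained in L2_space Q for every Borel probability measure Q. *)
definition covering_number_condition :: "(real^'d \<Rightarrow> real) \<Rightarrow> bool" where
  "covering_number_condition \<Lambda> \<longleftrightarrow>
     (\<exists>A>0. \<exists>v>0. \<forall>Q :: (real^'d) measure. prob_space Q \<longrightarrow> sets Q = sets borel \<longrightarrow>
        (\<forall>e. 0 < e \<and> e < 1 \<longrightarrow>
           ereal_of_enat (covering_number (e * (SUP z. \<bar>\<Lambda> z\<bar>)) Q (kernel_class \<Lambda>))
             \<le> ereal ((A / e) powr v)))"

definition asymptotic_as_confidence_regions ::
    "'w measure \<Rightarrow> (nat \<Rightarrow> 'w \<Rightarrow> 'p set) \<Rightarrow> 'p \<Rightarrow> bool" where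
  "asymptotic_as_confidence_regions M D \<theta> \<longleftrightarrow>
     (\<exists>\<Omega>\<^sub>0 \<in> sets M. measure M \<Omega>\<^sub>0 = 1 \<and> (\<forall>\<omega>\<in>\<Omega>\<^sub>0. \<exists>N. \<forall>n\<ge>N. \<theta> \<in> D n \<omega>))"

end

(* Let rate n = n hs^d / v^2.  The hypotheses imply ln n = o(rate n), so factors polynomial in n are
   negligible on the scale exp (rate n).

   Upper bound.  Since K and f are Hoelder continuous, a point x with a large deviation of the density
   estimator is surrounded by a ball of polynomially small radius of such points, so the probability that
   one exists is at most a power of n times the integral over x of the pointwise probabilities.  The latter
   are controlled by Chernoff bounds whose prefactors are integrable in x.  Applied to f_n this shows
   |f_n - f| <= eta eps everywhere, outside an event that is negligible on every exponential scale, so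
   max (f_n, eps) may be replaced by max (f, eps) up to a factor 1 - eta; applied to f_n^* it gives
   the constant delta^2 / 2, the optimal exponential parameter at x being
   delta / (v sqrt (kappa max (f x, eps))).

   Lower bound.  At one point with f x > 0, the normalised deviation of f_n^* has asymptotically Gaussian
   logarithmic moment generating function on the scale rate n, which yields the matching bound.

   The confidence statement follows from the upper bound by the Borel-Cantelli lemma. *)

theory Submission
  imports Defs "HOL-Real_Asymp.Real_Asymp"
begin

text \<open>The obstacle is uniformity over an unbounded domain on which f comes arbitrarily close
  to 0. Every error is therefore measured against the truncated density, which is at least eps, and
  this is where the hypotheses enter. At the optimal parameter the bias of f_n^*, of order hs^2,
  contributes v hs^2 / sqrt eps to the normalised exponent; the error of order hs in the second
  moment of the kernel is of order hs / eps relative to max (f x, eps); and since the parameter is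
  at most of order 1 / (v sqrt eps), the terms of the exponential beyond the second order vanish
  uniformly. For f_n the bias, of order h^2, has to be small against eps.

  Passing from one point to all points by integration requires pointwise bounds that are integrable
  in x, which a plain Chernoff bound is not. The missing decay comes from nonnegativity of the
  kernel: an upper deviation needs a kernel sum of positive size, whose mean is integrable in x, and
  a lower deviation by \<tau> needs f x >= \<tau>.\<close>

section \<open>Elementary inequalities, substitution and measurability\<close>

lemma exp_le_quadratic:
  fixes y :: real
  assumes "y \<ge> 0"
  shows "exp y \<le> 1 + y + y\<^sup>2 / 2 * exp y"
proof -
  have "\<exists>t. \<bar>t\<bar> \<le> \<bar>y\<bar> \<and> exp y = (\<Sum>m<2. y ^ m / fact m) + exp t / fact 2 * y ^ 2"
    by (rule Maclaurin_exp_le)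
  then obtain t where t: "\<bar>t\<bar> \<le> \<bar>y\<bar>" "exp y = (\<Sum>m<2. y ^ m / fact m) + exp t / fact 2 * y ^ 2"
    by blast
  have "exp t * y\<^sup>2 \<le> exp y * y\<^sup>2"
    using t(1) assms by (intro mult_right_mono) auto
  moreover have "exp y = 1 + y + exp t * y\<^sup>2 / 2"
    using t(2) by (simp add: numeral_2_eq_2)
  ultimately show ?thesis
    by (simp add: mult.commute)
qed

lemma exp_ge_quadratic:
  fixes y :: real
  assumes "y \<ge> 0"
  shows "1 + y + y\<^sup>2 / 2 \<le> exp y"
  using exp_lower_Taylor_quadratic[OF assms] by simp

lemma exp_minus_le_quadratic:
  fixes y :: real
  assumes "y \<ge> 0"
  shows "exp (- y) \<le> 1 - y + y\<^sup>2 / 2"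
proof -
  have "\<exists>t. \<bar>t\<bar> \<le> \<bar>- y\<bar> \<and> exp (- y) = (\<Sum>m<3. (- y) ^ m / fact m) + exp t / fact 3 * (- y) ^ 3"
    by (rule Maclaurin_exp_le)
  then obtain t where t: "exp (- y) = (\<Sum>m<3. (- y) ^ m / fact m) + exp t / fact 3 * (- y) ^ 3"
    by blast
  \<comment> \<open>The cubic remainder is nonpositive wherever the Lagrange point lies, so stopping
    at the square gives an upper bound for all y >= 0 with no exponential factor.\<close>
  have "exp t / fact 3 * (- y) ^ 3 \<le> 0"
    using assms by (simp add: mult_nonneg_nonpos power3_eq_cube mult_nonneg_nonneg)
  with t show ?thesis
    by (simp add: numeral_3_eq_3 numeral_2_eq_2)
qed

lemma exp_minus_one_le:
  fixes y :: real
  assumes "y \<ge> 0"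
  shows "exp y - 1 \<le> y * exp y"
  using exp_ge_add_one_self[of "- y"] mult_right_mono[of "1 - y" "exp (- y)" "exp y"]
  by (simp add: algebra_simps exp_minus)

lemma gradient_lipschitz:
  fixes f :: "'a::real_inner \<Rightarrow> real"
  assumes "\<And>x. GDERIV f x :> g x" and "\<And>x. norm (g x) \<le> G"
  shows "\<bar>f x - f y\<bar> \<le> G * norm (x - y)"
proof -
  have "onorm (\<lambda>h. h \<bullet> g z) \<le> G" for z
  proof (rule onorm_bound)
    show "0 \<le> G" using assms(2) norm_ge_zero order_trans by blast
    fix u show "norm (u \<bullet> g z) \<le> G * norm u"
      using Cauchy_Schwarz_ineq2[of u "g z"] mult_left_mono[OF assms(2)[of z], of "norm u"]
      by (simp add: mult.commute)
  qed
  then show ?thesis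
    using differentiable_bound[of UNIV f "\<lambda>z h. h \<bullet> g z" G x y] assms(1)
    by (simp add: gderiv_def)
qed

text \<open>The gradient varies by at most \<open>H * norm w\<close> on the ball of radius
  \<open>norm w\<close> around x, and the mean value inequality for f minus its linear part does the
  rest. Taylor's formula would give \<open>H / 2\<close>; the constant only enters \<open>C\<close>,
  whose size is immaterial.\<close>

lemma gradient_linearization:
  fixes f :: "'a::real_inner \<Rightarrow> real"
  assumes f: "\<And>x. GDERIV f x :> g x"
    and g: "\<And>x. (g has_derivative g' x) (at x)" and g': "\<And>x. onorm (g' x) \<le> H"
  shows "\<bar>f (x + w) - f x - g x \<bullet> w\<bar> \<le> H * (norm w)\<^sup>2"
proof -
  have lip: "norm (g y - g x) \<le> H * norm (y - x)" for y
    using differentiable_bound[of UNIV g g' H y x] g g' by simp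
  have H: "H \<ge> 0"
    using onorm_pos_le[OF has_derivative_bounded_linear[OF g]] g' order_trans by blast
  let ?S = "cball x (norm w)"
  have "norm (f (x + w) - f x - ((x + w) - x) \<bullet> g x) \<le> norm ((x + w) - x) * (H * norm w)"
  proof (rule differentiable_bound_linearization[where S="?S" and f'="\<lambda>z h. h \<bullet> g z"])
    show "x + t *\<^sub>R ((x + w) - x) \<in> ?S" if "t \<in> {0..1}" for t
      using that by (simp add: dist_norm mult_left_le_one_le)
    show "(f has_derivative (\<lambda>h. h \<bullet> g z)) (at z within ?S)" for z
      using f[of z] unfolding gderiv_def by (rule has_derivative_at_withinI)
    show "onorm ((\<lambda>h. h \<bullet> g z) - (\<lambda>h. h \<bullet> g x)) \<le> H * norm w" if "z \<in> ?S" for z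
    proof (rule onorm_bound)
      show "0 \<le> H * norm w" using H by simp
      fix u
      have "norm (u \<bullet> (g z - g x)) \<le> norm u * norm (g z - g x)"
        using Cauchy_Schwarz_ineq2 by simp
      also have "\<dots> \<le> norm u * (H * norm w)"
        using lip[of z] that H
        by (intro mult_left_mono order_trans[OF lip] mult_left_mono) (auto simp: dist_norm norm_minus_commute)
      finally show "norm (((\<lambda>h. h \<bullet> g z) - (\<lambda>h. h \<bullet> g x)) u) \<le> H * norm w * norm u"
        by (simp add: inner_diff_right mult.commute)
    qed
    show "x \<in> ?S" by simp
  qed
  then show ?thesis
    by (simp add: power2_eq_square inner_commute mult_ac)
qed

lemma integral_lborel_affine:
  fixes g :: "'a::euclidean_space \<Rightarrow> real"
  assumes [measurable]: "g \<in> borel_measurable borel" and "b > 0"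
  shows "(\<integral>y. g y \<partial>lborel) = b ^ DIM('a) * (\<integral>u. g (x - b *\<^sub>R u) \<partial>lborel)"
proof -
  have "(\<integral>y. g y \<partial>lborel)
      = (\<integral>y. g y \<partial>density (distr lborel borel (\<lambda>u. x + (- b) *\<^sub>R u)) (\<lambda>_. \<bar>- b\<bar> ^ DIM('a)))"
    using \<open>b > 0\<close> by (subst lborel_affine[of "- b" x]) auto
  also have "\<dots> = (\<integral>y. b ^ DIM('a) * g y \<partial>distr lborel borel (\<lambda>u. x + (- b) *\<^sub>R u))"
    using \<open>b > 0\<close>
    by (subst integral_real_density[symmetric]) (auto simp: ennreal_power)
  also have "\<dots> = b ^ DIM('a) * (\<integral>u. g (x - b *\<^sub>R u) \<partial>lborel)"
    by (subst integral_distr) auto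
  finally show ?thesis .
qed

lemma nn_integral_lborel_affine:
  fixes g :: "'a::euclidean_space \<Rightarrow> ennreal"
  assumes [measurable]: "g \<in> borel_measurable borel" and "c \<noteq> 0"
  shows "(\<integral>\<^sup>+y. g y \<partial>lborel) = ennreal (\<bar>c\<bar> ^ DIM('a)) * (\<integral>\<^sup>+u. g (x + c *\<^sub>R u) \<partial>lborel)"
  by (subst lborel_affine[OF \<open>c \<noteq> 0\<close>, of x])
     (simp add: nn_integral_density nn_integral_distr nn_integral_cmult ennreal_power)

lemma power_le_exp_mult:
  fixes z :: real
  assumes "0 \<le> 1 + z" shows "(1 + z) ^ n \<le> exp (real n * z)"
  using power_mono[OF exp_ge_add_one_self[of z] assms] by (simp add: exp_of_nat_mult)

text \<open>Above e the square root is Lipschitz with constant at most 1 / sqrt e. This transfers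
  the Lipschitz bound for max (f x) eps to thresholds proportional to its square root.\<close>

lemma sqrt_diff_le:
  fixes a b e :: real
  assumes "e > 0" "e \<le> a" "e \<le> b" "b - a \<le> r" "0 \<le> r"
  shows "sqrt b \<le> sqrt a + r / sqrt e"
proof (cases "sqrt b \<le> sqrt a")
  case True
  moreover have "0 \<le> r / sqrt e" using assms by simp
  ultimately show ?thesis by linarith
next
  case False
  have "(sqrt b - sqrt a) * sqrt e \<le> (sqrt b - sqrt a) * (sqrt b + sqrt a)"
    using assms False by (intro mult_left_mono) (auto simp: add_increasing2)
  also have "\<dots> = b - a"
    using assms by (simp add: algebra_simps)
  also have "\<dots> \<le> r" by fact
  finally show ?thesis
    using assms by (simp add: field_simps)
qed

lemma tendsto_sandwich_eventually:
  fixes g :: "nat \<Rightarrow> real"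
  assumes "eventually (\<lambda>n. l n \<le> g n \<and> g n \<le> u n) sequentially" "l \<longlonglongrightarrow> c" "u \<longlonglongrightarrow> c"
  shows "g \<longlonglongrightarrow> c"
  by (rule tendsto_sandwich[OF _ _ assms(2,3)]) (use assms(1) in \<open>auto elim: eventually_mono\<close>)

text \<open>The event is an uncountable union. By continuity its witnesses form an open set, so one
  of them lies in a countable dense set. Measurability is needed to compare such events by inclusion
  and by union bounds.\<close>

lemma sets_Ex_pos:
  fixes g :: "'w \<Rightarrow> 'a::second_countable_topology \<Rightarrow> real"
  assumes [measurable]: "\<And>x. (\<lambda>\<omega>. g \<omega> x) \<in> borel_measurable M" and cont: "\<And>\<omega>. continuous_on UNIV (g \<omega>)"
  shows "{\<omega> \<in> space M. \<exists>x. 0 < g \<omega> x} \<in> sets M"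
proof -
  obtain D :: "'a set" where D: "countable D" "\<And>U. open U \<Longrightarrow> U \<noteq> {} \<Longrightarrow> \<exists>d\<in>D. d \<in> U"
    using countable_dense_setE by metis
  have "(\<exists>x. 0 < g \<omega> x) \<longleftrightarrow> (\<exists>x\<in>D. 0 < g \<omega> x)" for \<omega>
  proof -
    have "open {x. 0 < g \<omega> x}"
      using cont by (intro open_Collect_less continuous_intros)
    then show ?thesis using D(2)[of "{x. 0 < g \<omega> x}"] by auto
  qed
  then have "{\<omega> \<in> space M. \<exists>x. 0 < g \<omega> x} = (\<Union>x\<in>D. {\<omega> \<in> space M. 0 < g \<omega> x})" by auto
  also have "\<dots> \<in> sets M" using D(1) by (intro sets.countable_UN') auto
  finally show ?thesis .
qed

section \<open>Deviations of kernel density estimators\<close>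

text \<open>Smoothness is recorded as inequalities with constants independent of the point, so that
  the estimates derived from them are uniform in x.\<close>

locale kde_model = prob_space M
  for M :: "'w measure" +
  fixes X :: "nat \<Rightarrow> 'w \<Rightarrow> real^'d"
    and f K :: "real^'d \<Rightarrow> real"
    and grad :: "real^'d \<Rightarrow> real^'d"
    and G H fmax Kmax L \<alpha> :: real
  assumes indep: "indep_vars (\<lambda>_. borel) X {1..}"
    and density: "\<And>j. j \<ge> 1 \<Longrightarrow> distributed M lborel (X j) (\<lambda>x. ennreal (f x))"
    and f_nonneg: "\<And>x. 0 \<le> f x"
    and f_le: "\<And>x. f x \<le> fmax"
    and f_lipschitz: "\<And>x y. \<bar>f x - f y\<bar> \<le> G * norm (x - y)"
    and f_taylor: "\<And>x w. \<bar>f (x + w) - f x - grad x \<bullet> w\<bar> \<le> H * (norm w)\<^sup>2"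
    and K_nonneg: "\<And>z. 0 \<le> K z"
    and K_le: "\<And>z. K z \<le> Kmax"
    and K_integrable: "integrable lborel K"
    and K_integral: "(\<integral>z. K z \<partial>lborel) = 1"
    and K_centered: "\<And>j. (\<integral>z. z $ j * K z \<partial>lborel) = 0"
    and K_moment2: "integrable lborel (\<lambda>z. (norm z)\<^sup>2 * K z)"
    and K_holder: "\<And>x y. \<bar>K x - K y\<bar> \<le> L * norm (x - y) powr \<alpha>"
    and G_nonneg: "0 \<le> G" and H_nonneg: "0 \<le> H" and L_nonneg: "0 \<le> L" and \<alpha>_pos: "0 < \<alpha>"
begin

lemma K_continuous: "continuous_on UNIV K"
proof (rule continuous_at_imp_continuous_on, rule ballI)
  fix x :: "real^'d"
  have "((\<lambda>y. L * norm (y - x) powr \<alpha>) \<longlongrightarrow> L * norm (x - x) powr \<alpha>) (at x)"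
    using \<alpha>_pos by (intro tendsto_intros tendsto_powr') auto
  then have "((\<lambda>y. L * norm (y - x) powr \<alpha>) \<longlongrightarrow> 0) (at x)" by simp
  then have "((\<lambda>y. K y - K x) \<longlongrightarrow> 0) (at x)"
    by (rule tendsto_0_le[where K=1]) (use K_holder in \<open>auto intro!: always_eventually order_trans[OF _ abs_ge_self]\<close>)
  then show "isCont K x"
    unfolding isCont_def by (simp add: LIM_zero_iff)
qed

lemma f_continuous: "continuous_on UNIV f"
proof (rule continuous_at_imp_continuous_on, rule ballI)
  fix x :: "real^'d"
  have "((\<lambda>y. G * norm (y - x)) \<longlongrightarrow> G * norm (x - x)) (at x)"
    by (intro tendsto_intros)
  then have "((\<lambda>y. G * norm (y - x)) \<longlongrightarrow> 0) (at x)" by simp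
  then have "((\<lambda>y. f y - f x) \<longlongrightarrow> 0) (at x)"
    by (rule tendsto_0_le[where K=1]) (use f_lipschitz in \<open>auto intro!: always_eventually order_trans[OF _ abs_ge_self]\<close>)
  then show "isCont f x"
    unfolding isCont_def by (simp add: LIM_zero_iff)
qed

lemma K_measurable [measurable]: "K \<in> borel_measurable borel"
  using borel_measurable_continuous_onI[OF K_continuous] .

lemma f_measurable [measurable]: "f \<in> borel_measurable borel"
  using borel_measurable_continuous_onI[OF f_continuous] .

lemma X_measurable [measurable]: "j \<ge> 1 \<Longrightarrow> X j \<in> borel_measurable M"
  using distributed_measurable[OF density] by simp

lemma expectation_X:
  assumes "j \<ge> 1" and [measurable]: "g \<in> borel_measurable borel"
  shows "expectation (\<lambda>\<omega>. g (X j \<omega>)) = (\<integral>y. f y * g y \<partial>lborel)"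
  using distributed_integral[OF density[OF assms(1)], of g] f_nonneg by simp

text \<open>The measure with density f is the law of \<open>X 1\<close>, so integrability of bounded
  functions against f is that of bounded random variables. With g = 1, this and
  \<open>expectation_X\<close> yield that f is integrable with integral 1.\<close>

lemma integrable_f_mult:
  fixes g :: "real^'d \<Rightarrow> real"
  assumes [measurable]: "g \<in> borel_measurable borel" and "\<And>y. \<bar>g y\<bar> \<le> B"
  shows "integrable lborel (\<lambda>y. f y * g y)"
proof -
  have "integrable M (\<lambda>\<omega>. g (X 1 \<omega>))"
    by (rule integrable_const_bound[where B=B]) (use assms(2) in auto)
  then show ?thesis
    using distributed_integrable[OF density[of 1], of g] f_nonneg by simp
qed

lemma f_integrable: "integrable lborel f"
  using integrable_f_mult[of "\<lambda>_. 1" 1] by simp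

lemma f_integral: "(\<integral>y. f y \<partial>lborel) = 1"
  using expectation_X[of 1 "\<lambda>_. 1"] by (simp add: prob_space)

lemma Kmax_pos: "Kmax > 0"
proof (rule ccontr)
  assume "\<not> Kmax > 0"
  then have "K = (\<lambda>_. 0)"
    using K_nonneg K_le by (intro ext) (meson le_less_linear order.trans dual_order.antisym less_imp_le)
  with K_integral show False by simp
qed

lemma fmax_nonneg: "fmax \<ge> 0"
  using f_nonneg f_le order_trans by blast

lemma exists_f_pos: "\<exists>x. f x > 0"
proof (rule ccontr)
  assume "\<nexists>x. f x > 0"
  then have "f = (\<lambda>_. 0)"
    using f_nonneg by (intro ext) (metis order_le_less)
  with f_integral show False by simp
qed

lemma integrable_K_mult:
  fixes g :: "real^'d \<Rightarrow> real"
  assumes [measurable]: "g \<in> borel_measurable borel" and "\<And>u. \<bar>g u\<bar> \<le> B * (1 + (norm u)\<^sup>2)"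
  shows "integrable lborel (\<lambda>u. K u * g u)"
proof (rule Bochner_Integration.integrable_bound)
  show "integrable lborel (\<lambda>u. B * (K u + (norm u)\<^sup>2 * K u))"
    using K_integrable K_moment2 by auto
  show "AE u in lborel. norm (K u * g u) \<le> norm (B * (K u + (norm u)\<^sup>2 * K u))"
  proof (rule AE_I2)
    fix u
    have "norm (K u * g u) \<le> K u * (B * (1 + (norm u)\<^sup>2))"
      using assms(2)[of u] K_nonneg[of u] by (auto simp: abs_mult intro!: mult_left_mono)
    also have "\<dots> = B * (K u + (norm u)\<^sup>2 * K u)" by (simp add: algebra_simps)
    finally show "norm (K u * g u) \<le> norm (B * (K u + (norm u)\<^sup>2 * K u))" by simp
  qed
qed auto

lemma K_inner_integral: "(\<integral>u. K u * (c \<bullet> u) \<partial>lborel) = 0"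
proof -
  \<comment> \<open>\<open>K_centered\<close> does not by itself give integrability, since the
    Bochner integral of a non-integrable function is 0. The second moment of K does.\<close>
  have i: "integrable lborel (\<lambda>u. c $ j * (u $ j * K u))" for j
  proof -
    have "integrable lborel (\<lambda>u. K u * (u $ j))"
    proof (rule integrable_K_mult[where B=1])
      fix u :: "real^'d"
      have "\<bar>u $ j\<bar> \<le> norm u" by (rule component_le_norm_cart)
      also have "\<dots> \<le> 1 * (1 + (norm u)\<^sup>2)"
        using zero_le_power2[of "norm u - 1/2"] by (simp add: power2_eq_square algebra_simps)
      finally show "\<bar>u $ j\<bar> \<le> 1 * (1 + (norm u)\<^sup>2)" .
    qed (auto intro!: borel_measurable_continuous_onI continuous_intros)
    then show ?thesis by (simp add: mult.commute)
  qed
  have "(\<integral>u. K u * (c \<bullet> u) \<partial>lborel) = (\<integral>u. (\<Sum>j\<in>UNIV. c $ j * (u $ j * K u)) \<partial>lborel)"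
    by (simp add: inner_vec_def sum_distrib_left mult_ac)
  also have "\<dots> = (\<Sum>j\<in>UNIV. \<integral>u. c $ j * (u $ j * K u) \<partial>lborel)"
    by (rule Bochner_Integration.integral_sum) (use i in auto)
  also have "\<dots> = 0"
    by (simp add: K_centered)
  finally show ?thesis .
qed

section \<open>First and second moments of the rescaled kernel\<close>

abbreviation \<kappa> :: real where "\<kappa> \<equiv> kappa K"

lemma K_sq_integrable: "integrable lborel (\<lambda>z. (K z)\<^sup>2)"
proof -
  have "\<bar>K u\<bar> \<le> Kmax * (1 + (norm u)\<^sup>2)" for u
    using K_nonneg[of u] K_le[of u] Kmax_pos by (simp add: algebra_simps add_increasing2)
  then show ?thesis
    using integrable_K_mult[of K Kmax] by (simp add: power2_eq_square)
qed

lemma \<kappa>_pos: "\<kappa> > 0"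
proof -
  have "\<kappa> \<ge> 0" unfolding kappa_def by (rule integral_nonneg_AE) simp
  moreover have "\<kappa> \<noteq> 0"
  proof
    assume "\<kappa> = 0"
    then have "AE z in lborel. K z = 0"
      unfolding kappa_def using integral_nonneg_eq_0_iff_AE[OF K_sq_integrable] by simp
    then have "(\<integral>z. K z \<partial>lborel) = (\<integral>z. 0 \<partial>(lborel :: (real^'d) measure))"
      by (intro integral_cong_AE) auto
    with K_integral show False by simp
  qed
  ultimately show ?thesis by simp
qed

text \<open>The expectation of K ((x - X 1) / b); \<open>q\<close> is the expectation of its square.
  Besides \<open>Kmax\<close>, these two moments are all that the bounds on exponential moments
  use.\<close>

definition p :: "real \<Rightarrow> real^'d \<Rightarrow> real"
  where "p b x = (\<integral>y. f y * K ((x - y) /\<^sub>R b) \<partial>lborel)"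

definition q :: "real \<Rightarrow> real^'d \<Rightarrow> real"
  where "q b x = (\<integral>y. f y * (K ((x - y) /\<^sub>R b))\<^sup>2 \<partial>lborel)"

text \<open>One constant for both moment expansions: the first term bounds the bias, the second the
  error of the second moment, and both are nonnegative.\<close>

definition C :: real
  where "C = H * (\<integral>u. K u * (norm u)\<^sup>2 \<partial>lborel) + G * (\<integral>u. K u * (K u * norm u) \<partial>lborel)"

lemma norm_le_one_plus_sq: "norm (u :: real^'d) \<le> 1 + (norm u)\<^sup>2"
  using zero_le_power2[of "norm u - 1/2"] by (simp add: power2_eq_square algebra_simps)

lemma integrable_K_norms:
  "integrable lborel (\<lambda>u. K u * (norm u)\<^sup>2)"
  "integrable lborel (\<lambda>u. K u * (K u * norm u))"
proof -
  show "integrable lborel (\<lambda>u. K u * (norm u)\<^sup>2)"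
    using integrable_K_mult[of "\<lambda>u. (norm u)\<^sup>2" 1] by simp
  show "integrable lborel (\<lambda>u. K u * (K u * norm u))"
  proof (rule integrable_K_mult[where B=Kmax])
    fix u show "\<bar>K u * norm u\<bar> \<le> Kmax * (1 + (norm u)\<^sup>2)"
      using K_nonneg[of u] K_le[of u] Kmax_pos norm_le_one_plus_sq[of u]
      by (auto simp: abs_mult intro!: mult_mono)
  qed simp
qed

lemma C_nonneg: "C \<ge> 0"
  unfolding C_def using K_nonneg G_nonneg H_nonneg
  by (intro add_nonneg_nonneg mult_nonneg_nonneg integral_nonneg_AE AE_I2) auto

lemma integrable_f_kernel_pow: "integrable lborel (\<lambda>y. f y * K ((x - y) /\<^sub>R b) ^ k)"
  by (rule integrable_f_mult[where B="Kmax ^ k"])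
     (auto simp: K_nonneg K_le abs_of_nonneg intro!: power_mono)

lemma p_nonneg: "p b x \<ge> 0"
  unfolding p_def by (rule integral_nonneg_AE) (auto simp: f_nonneg K_nonneg)

lemma q_nonneg: "q b x \<ge> 0"
  unfolding q_def by (rule integral_nonneg_AE) (auto simp: f_nonneg)

lemma p_affine:
  assumes "b > 0" shows "p b x = b ^ CARD('d) * (\<integral>u. K u * f (x - b *\<^sub>R u) \<partial>lborel)"
  unfolding p_def using assms
  by (subst integral_lborel_affine[where b=b and x=x]) (auto simp: mult.commute)

lemma q_affine:
  assumes "b > 0" shows "q b x = b ^ CARD('d) * (\<integral>u. (K u)\<^sup>2 * f (x - b *\<^sub>R u) \<partial>lborel)"
  unfolding q_def using assms
  by (subst integral_lborel_affine[where b=b and x=x]) (auto simp: mult.commute)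

lemma f_abs_le: "\<bar>f x\<bar> \<le> fmax * (1 + (norm u)\<^sup>2)"
  using f_nonneg[of x] f_le[of x] fmax_nonneg by (auto simp: algebra_simps intro: add_increasing2)

text \<open>After the substitution y = x - b u the error is the integral of K against an increment
  of f. Removing the linear part of that increment costs nothing because K is centered, and the
  remainder is of order b^2.\<close>

lemma p_approx:
  assumes "b > 0" shows "\<bar>p b x - b ^ CARD('d) * f x\<bar> \<le> b ^ CARD('d) * (C * b\<^sup>2)"
proof -
  have i1: "integrable lborel (\<lambda>u. K u * f (x - b *\<^sub>R u))"
    by (rule integrable_K_mult[where B=fmax]) (auto simp: f_abs_le)
  have i2: "integrable lborel (\<lambda>u. K u * (grad x \<bullet> u))"
  proof (rule integrable_K_mult[where B="norm (grad x)"])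
    fix u show "\<bar>grad x \<bullet> u\<bar> \<le> norm (grad x) * (1 + (norm u)\<^sup>2)"
      using Cauchy_Schwarz_ineq2[of "grad x" u] mult_left_mono[OF norm_le_one_plus_sq[of u], of "norm (grad x)"]
      by simp
  qed simp
  have "(\<integral>u. K u * f (x - b *\<^sub>R u) \<partial>lborel) - f x
      = (\<integral>u. K u * f (x - b *\<^sub>R u) - f x * K u + b * (K u * (grad x \<bullet> u)) \<partial>lborel)"
    using i1 i2 K_integrable by (simp add: K_integral K_inner_integral)
  also have "norm \<dots> \<le> (\<integral>u. H * b\<^sup>2 * (K u * (norm u)\<^sup>2) \<partial>lborel)"
  proof (rule Bochner_Integration.integral_norm_bound_integral)
    show "integrable lborel (\<lambda>u. K u * f (x - b *\<^sub>R u) - f x * K u + b * (K u * (grad x \<bullet> u)))"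
      using i1 i2 K_integrable by auto
    show "integrable lborel (\<lambda>u. H * b\<^sup>2 * (K u * (norm u)\<^sup>2))"
      using integrable_K_norms by auto
    fix u
    have "K u * f (x - b *\<^sub>R u) - f x * K u + b * (K u * (grad x \<bullet> u))
        = K u * (f (x + (- b) *\<^sub>R u) - f x - grad x \<bullet> ((- b) *\<^sub>R u))"
      by (simp add: algebra_simps)
    also have "norm \<dots> \<le> K u * (H * (norm ((- b) *\<^sub>R u))\<^sup>2)"
      using f_taylor[of x "(- b) *\<^sub>R u"] K_nonneg[of u] by (auto simp: abs_mult intro!: mult_left_mono)
    also have "\<dots> = H * b\<^sup>2 * (K u * (norm u)\<^sup>2)"
      by (simp add: power_mult_distrib)
    finally show "norm (K u * f (x - b *\<^sub>R u) - f x * K u + b * (K u * (grad x \<bullet> u)))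
        \<le> H * b\<^sup>2 * (K u * (norm u)\<^sup>2)" .
  qed
  also have "\<dots> \<le> C * b\<^sup>2"
  proof -
    have "0 \<le> G * (\<integral>u. K u * (K u * norm u) \<partial>lborel) * b\<^sup>2"
      using G_nonneg K_nonneg by (intro mult_nonneg_nonneg integral_nonneg_AE AE_I2) auto
    then show ?thesis
      unfolding C_def by (simp add: distrib_right)
  qed
  finally have "\<bar>(\<integral>u. K u * f (x - b *\<^sub>R u) \<partial>lborel) - f x\<bar> \<le> C * b\<^sup>2" by simp
  then have "b ^ CARD('d) * \<bar>(\<integral>u. K u * f (x - b *\<^sub>R u) \<partial>lborel) - f x\<bar> \<le> b ^ CARD('d) * (C * b\<^sup>2)"
    using assms by (intro mult_left_mono) auto
  then show ?thesis
    using assms by (simp add: p_affine abs_mult flip: right_diff_distrib)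
qed

text \<open>The square of K need not be centered, so the Lipschitz bound for f is used instead, and
  the error is of order b rather than b^2.\<close>

lemma q_approx:
  assumes "b > 0" shows "\<bar>q b x - b ^ CARD('d) * (\<kappa> * f x)\<bar> \<le> b ^ CARD('d) * (C * b)"
proof -
  have i1: "integrable lborel (\<lambda>u. (K u)\<^sup>2 * f (x - b *\<^sub>R u))"
  proof -
    have "integrable lborel (\<lambda>u. K u * (K u * f (x - b *\<^sub>R u)))"
    proof (rule integrable_K_mult[where B="Kmax * fmax"])
      fix u show "\<bar>K u * f (x - b *\<^sub>R u)\<bar> \<le> Kmax * fmax * (1 + (norm u)\<^sup>2)"
        unfolding abs_mult mult.assoc using f_abs_le[of "x - b *\<^sub>R u" u] K_nonneg[of u] K_le[of u] Kmax_pos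
        by (intro mult_mono) auto
    qed simp
    then show ?thesis by (simp add: power2_eq_square mult_ac)
  qed
  have "(\<integral>u. (K u)\<^sup>2 * f (x - b *\<^sub>R u) \<partial>lborel) - \<kappa> * f x
      = (\<integral>u. (K u)\<^sup>2 * f (x - b *\<^sub>R u) - (K u)\<^sup>2 * f x \<partial>lborel)"
    using i1 K_sq_integrable by (simp add: kappa_def)
  also have "norm \<dots> \<le> (\<integral>u. G * b * (K u * (K u * norm u)) \<partial>lborel)"
  proof (rule Bochner_Integration.integral_norm_bound_integral)
    show "integrable lborel (\<lambda>u. (K u)\<^sup>2 * f (x - b *\<^sub>R u) - (K u)\<^sup>2 * f x)"
      using i1 K_sq_integrable by auto
    show "integrable lborel (\<lambda>u. G * b * (K u * (K u * norm u)))"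
      using integrable_K_norms by auto
    fix u
    have "norm ((K u)\<^sup>2 * f (x - b *\<^sub>R u) - (K u)\<^sup>2 * f x) = (K u)\<^sup>2 * \<bar>f (x - b *\<^sub>R u) - f x\<bar>"
      by (simp add: abs_mult flip: right_diff_distrib)
    also have "\<dots> \<le> (K u)\<^sup>2 * (G * norm ((x - b *\<^sub>R u) - x))"
      using f_lipschitz[of "x - b *\<^sub>R u" x] by (rule mult_left_mono) simp
    also have "\<dots> = G * b * (K u * (K u * norm u))"
      using assms by (simp add: power2_eq_square)
    finally show "norm ((K u)\<^sup>2 * f (x - b *\<^sub>R u) - (K u)\<^sup>2 * f x) \<le> G * b * (K u * (K u * norm u))" .
  qed
  also have "\<dots> \<le> C * b"
  proof -
    have "0 \<le> H * (\<integral>u. K u * (norm u)\<^sup>2 \<partial>lborel) * b"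
      using H_nonneg K_nonneg assms by (intro mult_nonneg_nonneg integral_nonneg_AE AE_I2) auto
    then show ?thesis
      unfolding C_def by (simp add: distrib_right)
  qed
  finally have "\<bar>(\<integral>u. (K u)\<^sup>2 * f (x - b *\<^sub>R u) \<partial>lborel) - \<kappa> * f x\<bar> \<le> C * b" by simp
  then have "b ^ CARD('d) * \<bar>(\<integral>u. (K u)\<^sup>2 * f (x - b *\<^sub>R u) \<partial>lborel) - \<kappa> * f x\<bar> \<le> b ^ CARD('d) * (C * b)"
    using assms by (intro mult_left_mono) auto
  then show ?thesis
    using assms by (simp add: q_affine abs_mult flip: right_diff_distrib)
qed

section \<open>Exponential moments of the kernel sums\<close>

definition S :: "nat \<Rightarrow> real \<Rightarrow> real^'d \<Rightarrow> 'w \<Rightarrow> real"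
  where "S n b x \<omega> = (\<Sum>j=1..n. K ((x - X j \<omega>) /\<^sub>R b))"

definition mgf :: "real \<Rightarrow> real \<Rightarrow> real^'d \<Rightarrow> real"
  where "mgf s b x = (\<integral>y. f y * exp (s * K ((x - y) /\<^sub>R b)) \<partial>lborel)"

lemma S_measurable_pair [measurable]:
  "(\<lambda>(\<omega>, x). S n b x \<omega>) \<in> borel_measurable (M \<Otimes>\<^sub>M borel)"
  unfolding S_def by measurable

lemma S_measurable [measurable]: "S n b x \<in> borel_measurable M"
  unfolding S_def by measurable

lemma S_bounds: "0 \<le> S n b x \<omega>" "S n b x \<omega> \<le> real n * Kmax"
proof -
  show "0 \<le> S n b x \<omega>" unfolding S_def by (intro sum_nonneg) (simp add: K_nonneg)
  show "S n b x \<omega> \<le> real n * Kmax"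
    unfolding S_def using sum_bounded_above[of "{1..n}" "\<lambda>j. K ((x - X j \<omega>) /\<^sub>R b)" Kmax] K_le by simp
qed

lemma kde_eq_S: "kde K X n b \<omega> x = S n b x \<omega> / (real n * b ^ CARD('d))"
  by (simp add: kde_def S_def)

lemma integrable_exp_S: "integrable M (\<lambda>\<omega>. exp (s * S n b x \<omega>))"
proof (rule integrable_const_bound[where B="exp (\<bar>s\<bar> * (real n * Kmax))"])
  have "s * S n b x \<omega> \<le> \<bar>s\<bar> * (real n * Kmax)" for \<omega>
    by (rule order_trans[OF abs_ge_self])
       (auto simp: abs_mult S_bounds abs_of_nonneg intro!: mult_left_mono)
  then show "AE \<omega> in M. norm (exp (s * S n b x \<omega>)) \<le> exp (\<bar>s\<bar> * (real n * Kmax))" by simp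
qed simp

lemma expectation_exp_S: "expectation (\<lambda>\<omega>. exp (s * S n b x \<omega>)) = mgf s b x ^ n"
proof -
  let ?Y = "\<lambda>j \<omega>. exp (s * K ((x - X j \<omega>) /\<^sub>R b))"
  have "indep_vars (\<lambda>_. borel) ?Y {1..n}"
  proof (rule indep_vars_compose2[where Y="\<lambda>_ y. exp (s * K ((x - y) /\<^sub>R b))"])
    show "indep_vars (\<lambda>_. borel) X {1..n}"
      using indep by (rule indep_vars_subset) auto
  qed simp
  moreover have "integrable M (?Y j)" if "j \<in> {1..n}" for j
  proof (rule integrable_const_bound[where B="exp (\<bar>s\<bar> * Kmax)"])
    have "s * K z \<le> \<bar>s\<bar> * Kmax" for z
      by (rule order_trans[OF abs_ge_self])
         (auto simp: abs_mult K_nonneg K_le abs_of_nonneg intro!: mult_left_mono)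
    then show "AE \<omega> in M. norm (?Y j \<omega>) \<le> exp (\<bar>s\<bar> * Kmax)" by simp
  qed (use that in simp)
  ultimately have "expectation (\<lambda>\<omega>. \<Prod>j\<in>{1..n}. ?Y j \<omega>) = (\<Prod>j\<in>{1..n}. expectation (?Y j))"
    by (intro indep_vars_lebesgue_integral) auto
  also have "\<dots> = (\<Prod>j\<in>{1..n}. mgf s b x)"
    unfolding mgf_def by (intro prod.cong refl expectation_X) auto
  finally show ?thesis
    by (simp add: S_def exp_sum sum_distrib_left)
qed

lemma integrable_f_exp_kernel: "integrable lborel (\<lambda>y. f y * exp (s * K ((x - y) /\<^sub>R b)))"
proof (rule integrable_f_mult[where B="exp (\<bar>s\<bar> * Kmax)"])
  have "s * K z \<le> \<bar>s\<bar> * Kmax" for z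
    by (rule order_trans[OF abs_ge_self])
       (auto simp: abs_mult K_nonneg K_le abs_of_nonneg intro!: mult_left_mono)
  then show "\<bar>exp (s * K ((x - y) /\<^sub>R b))\<bar> \<le> exp (\<bar>s\<bar> * Kmax)" for y by simp
qed simp

lemma integral_f_quadratic_kernel:
  fixes a c b :: real and x :: "real^'d"
  shows "integrable lborel (\<lambda>y. f y * (1 + a * K ((x - y) /\<^sub>R b) + c * (K ((x - y) /\<^sub>R b))\<^sup>2))"
  "(\<integral>y. f y * (1 + a * K ((x - y) /\<^sub>R b) + c * (K ((x - y) /\<^sub>R b))\<^sup>2) \<partial>lborel) = 1 + a * p b x + c * q b x"
proof -
  have eq: "(\<lambda>y. f y * (1 + a * K ((x - y) /\<^sub>R b) + c * (K ((x - y) /\<^sub>R b))\<^sup>2))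
    = (\<lambda>y. f y + a * (f y * K ((x - y) /\<^sub>R b)) + c * (f y * (K ((x - y) /\<^sub>R b))\<^sup>2))"
    by (simp add: algebra_simps)
  have i: "integrable lborel (\<lambda>y. a * (f y * K ((x - y) /\<^sub>R b)))"
      "integrable lborel (\<lambda>y. c * (f y * (K ((x - y) /\<^sub>R b))\<^sup>2))"
    using integrable_f_kernel_pow[of b x 1] integrable_f_kernel_pow[of b x 2] by auto
  show "integrable lborel (\<lambda>y. f y * (1 + a * K ((x - y) /\<^sub>R b) + c * (K ((x - y) /\<^sub>R b))\<^sup>2))"
    unfolding eq using i f_integrable by auto
  show "(\<integral>y. f y * (1 + a * K ((x - y) /\<^sub>R b) + c * (K ((x - y) /\<^sub>R b))\<^sup>2) \<partial>lborel) = 1 + a * p b x + c * q b x"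
    unfolding eq using i f_integrable by (simp add: p_def q_def f_integral)
qed

text \<open>The exponential in the remainder is frozen at its largest value
  \<open>exp (s * Kmax)\<close>. This tends to 1 with s, so the quadratic coefficient remains
  asymptotically sharp.\<close>

lemma mgf_le:
  assumes "s \<ge> 0" shows "mgf s b x \<le> 1 + s * p b x + s\<^sup>2 / 2 * exp (s * Kmax) * q b x"
  unfolding mgf_def integral_f_quadratic_kernel(2)[symmetric]
proof (rule integral_mono[OF integrable_f_exp_kernel integral_f_quadratic_kernel(1)])
  fix y
  let ?k = "K ((x - y) /\<^sub>R b)"
  have "exp (s * ?k) \<le> 1 + s * ?k + (s * ?k)\<^sup>2 / 2 * exp (s * ?k)"
    using assms K_nonneg by (intro exp_le_quadratic) simp
  also have "\<dots> \<le> 1 + s * ?k + (s * ?k)\<^sup>2 / 2 * exp (s * Kmax)"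
    using assms K_le by (intro add_left_mono mult_left_mono) (auto intro!: mult_left_mono)
  also have "\<dots> = 1 + s * ?k + s\<^sup>2 / 2 * exp (s * Kmax) * ?k\<^sup>2"
    by (simp add: power_mult_distrib)
  finally show "f y * exp (s * ?k) \<le> f y * (1 + s * ?k + s\<^sup>2 / 2 * exp (s * Kmax) * ?k\<^sup>2)"
    using f_nonneg by (rule mult_left_mono)
qed

lemma mgf_ge:
  assumes "s \<ge> 0" shows "mgf s b x \<ge> 1 + s * p b x + s\<^sup>2 / 2 * q b x"
  unfolding mgf_def integral_f_quadratic_kernel(2)[symmetric]
proof (rule integral_mono[OF integral_f_quadratic_kernel(1) integrable_f_exp_kernel])
  fix y
  let ?k = "K ((x - y) /\<^sub>R b)"
  have "1 + s * ?k + (s * ?k)\<^sup>2 / 2 \<le> exp (s * ?k)"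
    using assms K_nonneg by (intro exp_ge_quadratic) simp
  then have "1 + s * ?k + s\<^sup>2 / 2 * ?k\<^sup>2 \<le> exp (s * ?k)"
    by (simp add: power_mult_distrib)
  then show "f y * (1 + s * ?k + s\<^sup>2 / 2 * ?k\<^sup>2) \<le> f y * exp (s * ?k)"
    using f_nonneg by (rule mult_left_mono)
qed

lemma mgf_uminus_le:
  assumes "s \<ge> 0" shows "mgf (- s) b x \<le> 1 - s * p b x + s\<^sup>2 / 2 * q b x"
proof -
  have "mgf (- s) b x \<le> 1 + (- s) * p b x + s\<^sup>2 / 2 * q b x"
    unfolding mgf_def integral_f_quadratic_kernel(2)[symmetric]
  proof (rule integral_mono[OF integrable_f_exp_kernel integral_f_quadratic_kernel(1)])
    fix y
    let ?k = "K ((x - y) /\<^sub>R b)"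
    have "exp (- (s * ?k)) \<le> 1 - s * ?k + (s * ?k)\<^sup>2 / 2"
      using assms K_nonneg by (intro exp_minus_le_quadratic) simp
    then have "exp (- s * ?k) \<le> 1 + (- s) * ?k + s\<^sup>2 / 2 * ?k\<^sup>2"
      by (simp add: power_mult_distrib)
    then show "f y * exp (- s * ?k) \<le> f y * (1 + (- s) * ?k + s\<^sup>2 / 2 * ?k\<^sup>2)"
      using f_nonneg by (rule mult_left_mono)
  qed
  then show ?thesis by simp
qed

text \<open>A first-order bound proportional to \<open>p b x\<close>, hence integrable over x by
  \<open>nn_integral_p\<close>. It supplies the prefactor of the upper deviation bound, while
  \<open>mgf_le\<close> supplies the exponent.\<close>

lemma mgf_minus_one_le:
  assumes "s \<ge> 0" shows "mgf s b x - 1 \<le> s * exp (s * Kmax) * p b x"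
proof -
  \<comment> \<open>The vanishing term in \<open>q\<close> brings the linear majorant into the form
    of \<open>integral_f_quadratic_kernel\<close>.\<close>
  have "mgf s b x \<le> 1 + s * exp (s * Kmax) * p b x + 0 * q b x"
    unfolding mgf_def integral_f_quadratic_kernel(2)[symmetric]
  proof (rule integral_mono[OF integrable_f_exp_kernel integral_f_quadratic_kernel(1)])
    fix y
    let ?k = "K ((x - y) /\<^sub>R b)"
    have "exp (s * ?k) \<le> 1 + s * ?k * exp (s * ?k)"
      using exp_minus_one_le[of "s * ?k"] assms K_nonneg[of "(x - y) /\<^sub>R b"] by simp
    also have "\<dots> \<le> 1 + s * ?k * exp (s * Kmax)"
      using assms K_le K_nonneg by (intro add_left_mono mult_left_mono) (auto intro!: mult_left_mono)
    finally have "exp (s * ?k) \<le> 1 + s * exp (s * Kmax) * ?k + 0 * ?k\<^sup>2"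
      by (simp add: mult_ac)
    then show "f y * exp (s * ?k) \<le> f y * (1 + s * exp (s * Kmax) * ?k + 0 * ?k\<^sup>2)"
      using f_nonneg by (rule mult_left_mono)
  qed
  then show ?thesis by simp
qed

section \<open>Pointwise deviation bounds\<close>

lemma mgf_power_nonneg: "mgf s b x ^ n \<ge> 0"
  unfolding expectation_exp_S[symmetric] by (rule integral_nonneg_AE) simp

text \<open>Subtracting 1 in Markov's inequality makes the prefactor integrable in \<open>x\<close>.\<close>

lemma kde_upper_deviation:
  assumes n: "n \<ge> 1" and b: "b > 0" and s: "0 \<le> s" "s \<le> 1"
    and N: "N = real n * b ^ CARD('d)" and large: "1 \<le> s * N * \<tau>"
  shows "prob {\<omega> \<in> space M. f x + \<tau> \<le> kde K X n b \<omega> x}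
    \<le> 2 * exp Kmax * real n * p b x
      * exp (N * (s * (C * b\<^sup>2) + s\<^sup>2 / 2 * exp (s * Kmax) * (\<kappa> * f x + C * b) - s * \<tau>))"
proof -
  define t where "t = N * (f x + \<tau>)"
  define \<psi> where "\<psi> = mgf s b x - 1"
  have Npos: "N > 0" using n b N by simp
  have st: "s * t \<ge> 1"
  proof -
    have "0 \<le> s * N * f x" using s Npos f_nonneg[of x] by simp
    then have "1 \<le> s * N * f x + s * N * \<tau>" using large by linarith
    then show ?thesis by (simp add: t_def ring_distribs mult_ac)
  qed
  have \<psi>0: "\<psi> \<ge> 0"
    using mgf_ge[OF s(1), of b x] mult_nonneg_nonneg[OF s(1) p_nonneg[of b x]] q_nonneg[of b x]
    by (simp add: \<psi>_def) (smt (verit) divide_nonneg_nonneg mult_nonneg_nonneg zero_le_power2)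
  have \<psi>1: "\<psi> \<le> exp Kmax * p b x"
  proof -
    have "s * exp (s * Kmax) \<le> 1 * exp (1 * Kmax)"
      using s Kmax_pos by (intro mult_mono) auto
    then have "s * exp (s * Kmax) * p b x \<le> exp Kmax * p b x"
      using p_nonneg by (intro mult_right_mono) auto
    then show ?thesis
      using mgf_minus_one_le[OF s(1), of b x] by (simp add: \<psi>_def)
  qed
  have \<psi>2: "real n * \<psi> \<le> N * (s * (f x + C * b\<^sup>2) + s\<^sup>2 / 2 * exp (s * Kmax) * (\<kappa> * f x + C * b))"
  proof -
    have "\<psi> \<le> s * p b x + s\<^sup>2 / 2 * exp (s * Kmax) * q b x"
      using mgf_le[OF s(1), of b x] by (simp add: \<psi>_def)
    also have "\<dots> \<le> s * (b ^ CARD('d) * (f x + C * b\<^sup>2))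
        + s\<^sup>2 / 2 * exp (s * Kmax) * (b ^ CARD('d) * (\<kappa> * f x + C * b))"
      using p_approx[OF b, of x] q_approx[OF b, of x] s
      by (intro add_mono mult_left_mono) (auto simp: algebra_simps abs_le_iff)
    also have "\<dots> = b ^ CARD('d) * (s * (f x + C * b\<^sup>2) + s\<^sup>2 / 2 * exp (s * Kmax) * (\<kappa> * f x + C * b))"
      by (simp add: algebra_simps)
    finally show ?thesis
      unfolding N mult.assoc by (intro mult_left_mono) auto
  qed
  have "{\<omega> \<in> space M. f x + \<tau> \<le> kde K X n b \<omega> x} = {\<omega> \<in> space M. t \<le> S n b x \<omega>}"
    using Npos by (simp add: kde_eq_S N[symmetric] t_def field_simps)
  also have "\<dots> \<subseteq> {\<omega> \<in> space M. exp (s * t) - 1 \<le> exp (s * S n b x \<omega>) - 1}"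
    using s by (auto intro!: mult_left_mono)
  finally have "prob {\<omega> \<in> space M. f x + \<tau> \<le> kde K X n b \<omega> x}
      \<le> prob {\<omega> \<in> space M. exp (s * t) - 1 \<le> exp (s * S n b x \<omega>) - 1}"
    by (intro finite_measure_mono) auto
  also have "\<dots> \<le> expectation (\<lambda>\<omega>. exp (s * S n b x \<omega>) - 1) / (exp (s * t) - 1)"
    using st s S_bounds(1)
    by (intro integral_Markov_inequality_measure[where A="{}"] Bochner_Integration.integrable_diff integrable_exp_S) auto
  also have "expectation (\<lambda>\<omega>. exp (s * S n b x \<omega>) - 1) = (1 + \<psi>) ^ n - 1"
    by (simp add: integrable_exp_S expectation_exp_S \<psi>_def prob_space)
  \<comment> \<open>One factor \<psi> is kept outside the exponential: there the crude bound by
    \<open>p b x\<close> suffices, whereas inside the exponential the sharp second-order bound is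
    used.\<close>
  also have "((1 + \<psi>) ^ n - 1) / (exp (s * t) - 1) \<le> real n * \<psi> * exp (real n * \<psi>) / (exp (s * t) - 1)"
  proof (rule divide_right_mono)
    show "(1 + \<psi>) ^ n - 1 \<le> real n * \<psi> * exp (real n * \<psi>)"
      using power_le_exp_mult[of \<psi> n] exp_minus_one_le[of "real n * \<psi>"] \<psi>0 by simp
    show "0 \<le> exp (s * t) - 1" using st by simp
  qed
  \<comment> \<open>Hypothesis \<open>large\<close> gives s * t >= 1, so exp (s * t) >= 2 and the
    subtracted 1 costs only a factor 2.\<close>
  also have "real n * \<psi> * exp (real n * \<psi>) / (exp (s * t) - 1) \<le> real n * \<psi> * exp (real n * \<psi>) / (exp (s * t) / 2)"
  proof (rule divide_left_mono)
    have "2 \<le> exp (s * t)" using exp_ge_add_one_self[of "s * t"] st by linarith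
    then have "0 < exp (s * t) - 1" by linarith
    then show "0 < (exp (s * t) - 1) * (exp (s * t) / 2)" by (rule mult_pos_pos) simp
    show "exp (s * t) / 2 \<le> exp (s * t) - 1" using \<open>2 \<le> exp (s * t)\<close> by linarith
  qed (use \<psi>0 in auto)
  also have "\<dots> = 2 * (real n * \<psi>) * exp (real n * \<psi> - s * t)"
    by (simp add: exp_diff)
  also have "\<dots> \<le> 2 * (real n * (exp Kmax * p b x))
      * exp (N * (s * (C * b\<^sup>2) + s\<^sup>2 / 2 * exp (s * Kmax) * (\<kappa> * f x + C * b) - s * \<tau>))"
  proof (rule mult_mono)
    show "2 * (real n * \<psi>) \<le> 2 * (real n * (exp Kmax * p b x))"
      using \<psi>1 by (intro mult_left_mono) auto
    have "N * (s * (f x + C * b\<^sup>2) + s\<^sup>2 / 2 * exp (s * Kmax) * (\<kappa> * f x + C * b)) - s * t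
        = N * (s * (C * b\<^sup>2) + s\<^sup>2 / 2 * exp (s * Kmax) * (\<kappa> * f x + C * b) - s * \<tau>)"
      by (simp add: t_def algebra_simps)
    then show "exp (real n * \<psi> - s * t) \<le> exp (N * (s * (C * b\<^sup>2) + s\<^sup>2 / 2 * exp (s * Kmax) * (\<kappa> * f x + C * b) - s * \<tau>))"
      using \<psi>2 by simp
  qed (use p_nonneg in auto)
  also have "2 * (real n * (exp Kmax * p b x)) = 2 * exp Kmax * real n * p b x"
    by simp
  finally show ?thesis .
qed

text \<open>The estimator is nonnegative, so the event is empty when \<tau> > f x; otherwise f x /
  \<tau> >= 1 and may be inserted for free, which makes the prefactor integrable in x. The factor
  \<open>exp (s * Kmax)\<close> is inserted so that both tails share one exponent.\<close>

lemma kde_lower_deviation: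
  assumes n: "n \<ge> 1" and b: "b > 0" and s: "0 \<le> s" and \<tau>: "\<tau> > 0"
    and N: "N = real n * b ^ CARD('d)"
  shows "prob {\<omega> \<in> space M. kde K X n b \<omega> x \<le> f x - \<tau>}
    \<le> f x / \<tau> * exp (N * (s * (C * b\<^sup>2) + s\<^sup>2 / 2 * exp (s * Kmax) * (\<kappa> * f x + C * b) - s * \<tau>))"
    (is "_ \<le> _ * exp (N * ?E)")
proof (cases "\<tau> \<le> f x")
  case False
  have "{\<omega> \<in> space M. kde K X n b \<omega> x \<le> f x - \<tau>} = {}"
    using False S_bounds(1)[of n b x] b by (auto simp: kde_eq_S not_le intro: less_le_trans[of _ 0])
  then have "prob {\<omega> \<in> space M. kde K X n b \<omega> x \<le> f x - \<tau>} = 0"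
    by (simp only: measure_empty)
  moreover have "0 \<le> f x / \<tau> * exp (N * ?E)"
    using f_nonneg[of x] \<tau> by simp
  ultimately show ?thesis by simp
next
  case True
  define t where "t = N * (f x - \<tau>)"
  define \<psi> where "\<psi> = mgf (- s) b x - 1"
  have Npos: "N > 0" using n b N by simp
  have \<psi>1: "0 \<le> 1 + \<psi>"
    using mgf_power_nonneg[of "-s" b x 1] by (simp add: \<psi>_def)
  have \<psi>2: "real n * \<psi> \<le> N * (s * (- f x + C * b\<^sup>2) + s\<^sup>2 / 2 * exp (s * Kmax) * (\<kappa> * f x + C * b))"
  proof -
    have "\<psi> \<le> s * (- p b x) + s\<^sup>2 / 2 * 1 * q b x"
      using mgf_uminus_le[OF s, of b x] by (simp add: \<psi>_def)
    also have "\<dots> \<le> s * (b ^ CARD('d) * (- f x + C * b\<^sup>2))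
        + s\<^sup>2 / 2 * exp (s * Kmax) * (b ^ CARD('d) * (\<kappa> * f x + C * b))"
      using p_approx[OF b, of x] q_approx[OF b, of x] s Kmax_pos q_nonneg
      by (intro add_mono mult_mono mult_left_mono) (auto simp: algebra_simps abs_le_iff)
    also have "\<dots> = b ^ CARD('d) * (s * (- f x + C * b\<^sup>2) + s\<^sup>2 / 2 * exp (s * Kmax) * (\<kappa> * f x + C * b))"
      by (simp add: algebra_simps)
    finally show ?thesis
      unfolding N mult.assoc by (intro mult_left_mono) auto
  qed
  have "{\<omega> \<in> space M. kde K X n b \<omega> x \<le> f x - \<tau>} = {\<omega> \<in> space M. S n b x \<omega> \<le> t}"
    using Npos by (simp add: kde_eq_S N[symmetric] t_def field_simps)
  also have "\<dots> \<subseteq> {\<omega> \<in> space M. exp (- s * t) \<le> exp (- s * S n b x \<omega>)}"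
    using s by (auto intro!: mult_left_mono)
  finally have "prob {\<omega> \<in> space M. kde K X n b \<omega> x \<le> f x - \<tau>}
      \<le> prob {\<omega> \<in> space M. exp (- s * t) \<le> exp (- s * S n b x \<omega>)}"
    by (intro finite_measure_mono) auto
  also have "\<dots> \<le> expectation (\<lambda>\<omega>. exp (- s * S n b x \<omega>)) / exp (- s * t)"
    by (intro integral_Markov_inequality_measure[where A="{}"] integrable_exp_S) auto
  also have "expectation (\<lambda>\<omega>. exp (- s * S n b x \<omega>)) = (1 + \<psi>) ^ n"
    by (simp only: expectation_exp_S \<psi>_def) simp
  also have "(1 + \<psi>) ^ n / exp (- s * t) \<le> exp (real n * \<psi>) / exp (- s * t)"
    using power_le_exp_mult[OF \<psi>1] by (intro divide_right_mono) auto
  also have "\<dots> = exp (real n * \<psi> + s * t)"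
    by (simp add: exp_add exp_minus field_simps)
  also have "\<dots> \<le> exp (N * ?E)"
    using \<psi>2 by (simp add: t_def algebra_simps)
  also have "\<dots> \<le> f x / \<tau> * exp (N * ?E)"
    using mult_right_mono[of 1 "f x / \<tau>" "exp (N * ?E)"] True \<tau> by simp
  finally show ?thesis .
qed

lemma kde_measurable_pair [measurable]:
  "(\<lambda>(\<omega>, x). kde K X n b \<omega> x) \<in> borel_measurable (M \<Otimes>\<^sub>M borel)"
  unfolding kde_eq_S by measurable

lemma kde_measurable [measurable]: "(\<lambda>\<omega>. kde K X n b \<omega> x) \<in> borel_measurable M"
  unfolding kde_eq_S by measurable

lemma kde_deviation:
  assumes n: "n \<ge> 1" and b: "b > 0" and s: "0 \<le> s" "s \<le> 1" and \<tau>: "\<tau> > 0"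
    and N: "N = real n * b ^ CARD('d)" and large: "1 \<le> s * N * \<tau>"
  shows "prob {\<omega> \<in> space M. \<tau> \<le> \<bar>kde K X n b \<omega> x - f x\<bar>}
    \<le> (2 * exp Kmax * real n * p b x + f x / \<tau>)
      * exp (N * (s * (C * b\<^sup>2) + s\<^sup>2 / 2 * exp (s * Kmax) * (\<kappa> * f x + C * b) - s * \<tau>))"
proof -
  have "{\<omega> \<in> space M. \<tau> \<le> \<bar>kde K X n b \<omega> x - f x\<bar>}
    = {\<omega> \<in> space M. f x + \<tau> \<le> kde K X n b \<omega> x} \<union> {\<omega> \<in> space M. kde K X n b \<omega> x \<le> f x - \<tau>}"
    using \<tau> by (auto simp: abs_real_def split: if_splits)
  then have "prob {\<omega> \<in> space M. \<tau> \<le> \<bar>kde K X n b \<omega> x - f x\<bar>}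
    \<le> prob {\<omega> \<in> space M. f x + \<tau> \<le> kde K X n b \<omega> x} + prob {\<omega> \<in> space M. kde K X n b \<omega> x \<le> f x - \<tau>}"
    by (simp add: measure_Un_le)
  then show ?thesis
    using kde_upper_deviation[OF n b s N large, of x] kde_lower_deviation[OF n b s(1) \<tau> N, of x]
    by (simp add: distrib_right)
qed

section \<open>From pointwise to uniform deviations\<close>

lemma p_measurable [measurable]: "p b \<in> borel_measurable borel"
  unfolding p_def by measurable

text \<open>\<open>p b\<close> is the convolution of the density f with K (z / b), whose integral is
  b^d, so Tonelli's theorem applies.\<close>

lemma nn_integral_p:
  assumes "b > 0" shows "(\<integral>\<^sup>+x. p b x \<partial>lborel) = ennreal (b ^ CARD('d))"
proof -
  have "(\<integral>\<^sup>+x. p b x \<partial>lborel) = (\<integral>\<^sup>+x. \<integral>\<^sup>+y. ennreal (f y * K ((x - y) /\<^sub>R b)) \<partial>lborel \<partial>lborel)"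
    unfolding p_def using integrable_f_kernel_pow[of b _ 1] f_nonneg K_nonneg
    by (intro nn_integral_cong nn_integral_eq_integral[symmetric]) auto
  also have "\<dots> = (\<integral>\<^sup>+y. \<integral>\<^sup>+x. ennreal (f y * K ((x - y) /\<^sub>R b)) \<partial>lborel \<partial>lborel)"
    by (rule lborel_pair.Fubini') measurable
  also have "\<dots> = (\<integral>\<^sup>+y. ennreal (b ^ CARD('d)) * ennreal (f y) \<partial>lborel)"
  proof (rule nn_integral_cong)
    fix y
    have "(\<integral>\<^sup>+x. ennreal (f y * K ((x - y) /\<^sub>R b)) \<partial>lborel)
        = ennreal (\<bar>b\<bar> ^ DIM(real^'d)) * (\<integral>\<^sup>+u. ennreal (f y * K (((y + b *\<^sub>R u) - y) /\<^sub>R b)) \<partial>lborel)"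
      using assms by (intro nn_integral_lborel_affine) auto
    also have "(\<integral>\<^sup>+u. ennreal (f y * K (((y + b *\<^sub>R u) - y) /\<^sub>R b)) \<partial>lborel) = ennreal (f y)"
      using assms K_integrable K_nonneg f_nonneg K_integral
      by (subst nn_integral_eq_integral) auto
    finally show "(\<integral>\<^sup>+x. ennreal (f y * K ((x - y) /\<^sub>R b)) \<partial>lborel) = ennreal (b ^ CARD('d)) * ennreal (f y)"
      using assms by simp
  qed
  also have "\<dots> = ennreal (b ^ CARD('d)) * (\<integral>\<^sup>+y. ennreal (f y) \<partial>lborel)"
    by (rule nn_integral_cmult) simp
  also have "(\<integral>\<^sup>+y. ennreal (f y) \<partial>lborel) = 1"
    using nn_integral_eq_integral[OF f_integrable] f_nonneg f_integral by simp
  finally show ?thesis by simp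
qed

lemma kde_perturb:
  assumes n: "n \<ge> 1" and b: "b > 0" and xy: "norm (x - y) \<le> \<rho>"
  shows "\<bar>kde K X n b \<omega> x - kde K X n b \<omega> y\<bar> \<le> L * (\<rho> / b) powr \<alpha> / b ^ CARD('d)"
proof -
  have "\<bar>S n b x \<omega> - S n b y \<omega>\<bar> \<le> (\<Sum>j=1..n. \<bar>K ((x - X j \<omega>) /\<^sub>R b) - K ((y - X j \<omega>) /\<^sub>R b)\<bar>)"
    unfolding S_def sum_subtractf[symmetric] by (rule sum_abs)
  also have "\<dots> \<le> (\<Sum>j=1..n. L * (\<rho> / b) powr \<alpha>)"
  proof (rule sum_mono)
    fix j
    have "\<bar>K ((x - X j \<omega>) /\<^sub>R b) - K ((y - X j \<omega>) /\<^sub>R b)\<bar> \<le> L * norm ((x - X j \<omega>) /\<^sub>R b - (y - X j \<omega>) /\<^sub>R b) powr \<alpha>"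
      by (rule K_holder)
    also have "(x - X j \<omega>) /\<^sub>R b - (y - X j \<omega>) /\<^sub>R b = (x - y) /\<^sub>R b"
      by (simp add: algebra_simps)
    also have "L * norm ((x - y) /\<^sub>R b) powr \<alpha> \<le> L * (\<rho> / b) powr \<alpha>"
      using xy b \<alpha>_pos L_nonneg
      by (intro mult_left_mono powr_mono2) (auto simp: divide_inverse mult.commute intro!: mult_left_mono)
    finally show "\<bar>K ((x - X j \<omega>) /\<^sub>R b) - K ((y - X j \<omega>) /\<^sub>R b)\<bar> \<le> L * (\<rho> / b) powr \<alpha>" .
  qed
  finally have "\<bar>S n b x \<omega> - S n b y \<omega>\<bar> \<le> real n * (L * (\<rho> / b) powr \<alpha>)" by simp
  then have "\<bar>S n b x \<omega> - S n b y \<omega>\<bar> / (real n * b ^ CARD('d)) \<le> real n * (L * (\<rho> / b) powr \<alpha>) / (real n * b ^ CARD('d))"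
    using b by (intro divide_right_mono) auto
  moreover have "\<bar>kde K X n b \<omega> x - kde K X n b \<omega> y\<bar> = \<bar>S n b x \<omega> - S n b y \<omega>\<bar> / (real n * b ^ CARD('d))"
    using b by (simp add: kde_eq_S diff_divide_distrib[symmetric])
  ultimately show ?thesis using n by simp
qed

text \<open>If \<open>x\<close> is a point of large deviation, then so is every point of a ball around \<open>x\<close>; hence the
  probability that such a point exists is at most the integral over the whole space of the
  pointwise probabilities, divided by the volume of the ball.  This replaces a covering argument.\<close>

lemma uniform_deviation:
  fixes \<tau> \<tau>' s :: "real^'d \<Rightarrow> real"
  assumes n: "n \<ge> 1" and b: "0 < b" "b \<le> 1" and \<rho>: "\<rho> > 0" and N: "N = real n * b ^ CARD('d)"
    and \<tau>_meas [measurable]: "\<tau> \<in> borel_measurable borel"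
    and \<tau>0: "0 < \<tau>0" "\<And>y. \<tau>0 \<le> \<tau> y"
    and s: "\<And>y. 0 \<le> s y" "\<And>y. s y \<le> 1" and large: "\<And>y. 1 \<le> s y * N * \<tau> y"
    and expo: "\<And>y. N * (s y * (C * b\<^sup>2) + (s y)\<^sup>2 / 2 * exp (s y * Kmax) * (\<kappa> * f y + C * b) - s y * \<tau> y) \<le> - E"
    and perturb: "\<And>x y. norm (x - y) \<le> \<rho> \<Longrightarrow> \<tau> y + L * (\<rho> / b) powr \<alpha> / b ^ CARD('d) + G * \<rho> \<le> \<tau>' x"
  shows "prob {\<omega> \<in> space M. \<exists>x. \<tau>' x < \<bar>kde K X n b \<omega> x - f x\<bar>}
    \<le> (2 * exp Kmax * real n + 1 / \<tau>0) * exp (- E) / (unit_ball_vol (CARD('d)) * \<rho> ^ CARD('d))"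
proof -
  define A where "A = {\<omega> \<in> space M. \<exists>x. \<tau>' x < \<bar>kde K X n b \<omega> x - f x\<bar>}"
  define V where "V = unit_ball_vol (CARD('d)) * \<rho> ^ CARD('d)"
  define D where "D = 2 * exp Kmax * real n"
  have V: "V > 0" unfolding V_def using \<rho> by simp
  have D: "D \<ge> 0" unfolding D_def by simp
  let ?B = "{z \<in> space (M \<Otimes>\<^sub>M lborel). \<tau> (snd z) \<le> \<bar>kde K X n b (fst z) (snd z) - f (snd z)\<bar>}"
  have B: "?B \<in> sets (M \<Otimes>\<^sub>M lborel)"
  proof -
    have [measurable]: "(\<lambda>z. kde K X n b (fst z) (snd z)) \<in> borel_measurable (M \<Otimes>\<^sub>M lborel)"
      using kde_measurable_pair[of n b] by (simp add: case_prod_beta cong: measurable_cong_sets)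
    show ?thesis by measurable
  qed
  have point: "emeasure M {\<omega> \<in> space M. \<tau> y \<le> \<bar>kde K X n b \<omega> y - f y\<bar>}
      \<le> ennreal (exp (- E)) * (ennreal D * ennreal (p b y) + ennreal (1 / \<tau>0) * ennreal (f y))" for y
  proof -
    have "\<tau> y > 0" using \<tau>0(1) \<tau>0(2)[of y] by linarith
    then have "prob {\<omega> \<in> space M. \<tau> y \<le> \<bar>kde K X n b \<omega> y - f y\<bar>}
      \<le> (2 * exp Kmax * real n * p b y + f y / \<tau> y)
        * exp (N * (s y * (C * b\<^sup>2) + (s y)\<^sup>2 / 2 * exp (s y * Kmax) * (\<kappa> * f y + C * b) - s y * \<tau> y))"
      by (intro kde_deviation n b s N large)
    also have "\<dots> \<le> (D * p b y + 1 / \<tau>0 * f y) * exp (- E)"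
    proof (rule mult_mono)
      have "f y / \<tau> y \<le> 1 / \<tau>0 * f y"
        using frac_le[of "f y" "f y" \<tau>0 "\<tau> y"] f_nonneg[of y] \<tau>0 by simp
      then show "2 * exp Kmax * real n * p b y + f y / \<tau> y \<le> D * p b y + 1 / \<tau>0 * f y"
        by (simp add: D_def)
    qed (use expo[of y] D p_nonneg f_nonneg \<tau>0 in auto)
    finally have "ennreal (prob {\<omega> \<in> space M. \<tau> y \<le> \<bar>kde K X n b \<omega> y - f y\<bar>})
        \<le> ennreal (exp (- E) * (D * p b y + 1 / \<tau>0 * f y))"
      by (intro ennreal_leI) (simp add: mult.commute)
    also have "\<dots> = ennreal (exp (- E)) * (ennreal D * ennreal (p b y) + ennreal (1 / \<tau>0) * ennreal (f y))"
    proof -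
      have "0 \<le> 1 / \<tau>0" using \<tau>0 by simp
      then show ?thesis
        using D p_nonneg f_nonneg
        by (subst ennreal_mult, simp, simp, subst ennreal_plus, simp, simp,
            subst ennreal_mult, simp, simp, subst ennreal_mult) auto
    qed
    finally show ?thesis by (simp add: emeasure_eq_measure)
  qed
  have "ennreal (V * prob A) \<le> ennreal (exp (- E) * (D + 1 / \<tau>0))"
  \<comment> \<open>Nothing is assumed about the dependence of \<tau>' on x, so \<open>A\<close> may
    fail to be measurable; its \<open>measure\<close> is then 0 by default.\<close>
  proof (cases "A \<in> sets M")
    case False
    then show ?thesis by (simp add: measure_notin_sets)
  next
    case A: True
    have ball: "ennreal V * indicator A \<omega> \<le> (\<integral>\<^sup>+y. indicator ?B (\<omega>, y) \<partial>lborel)" if "\<omega> \<in> space M" for \<omega>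
    proof (cases "\<omega> \<in> A")
      case True
      then obtain x where x: "\<tau>' x < \<bar>kde K X n b \<omega> x - f x\<bar>"
        unfolding A_def by blast
      have "ennreal V = emeasure lborel (cball x \<rho>)"
        using \<rho> by (simp add: emeasure_cball V_def)
      also have "\<dots> = (\<integral>\<^sup>+y. indicator (cball x \<rho>) y \<partial>lborel)"
        by simp
      also have "\<dots> \<le> (\<integral>\<^sup>+y. indicator ?B (\<omega>, y) \<partial>lborel)"
      proof (rule nn_integral_mono)
        fix y
        have "(\<omega>, y) \<in> ?B" if "y \<in> cball x \<rho>"
        proof -
          have xy: "norm (x - y) \<le> \<rho>" using that by (simp add: dist_norm)
          have "\<bar>f x - f y\<bar> \<le> G * \<rho>"
            using f_lipschitz[of x y] mult_left_mono[OF xy G_nonneg] by linarith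
          then have "\<tau> y \<le> \<bar>kde K X n b \<omega> y - f y\<bar>"
            using kde_perturb[OF n b(1) xy, of \<omega>] perturb[OF xy] x by linarith
          then show ?thesis using \<open>\<omega> \<in> space M\<close> by (simp add: space_pair_measure)
        qed
        then show "indicator (cball x \<rho>) y \<le> (indicator ?B (\<omega>, y) :: ennreal)"
          by (auto simp: indicator_def)
      qed
      finally show ?thesis using True by simp
    qed simp
    have "ennreal (V * prob A) = ennreal V * emeasure M A"
      using V by (simp add: emeasure_eq_measure ennreal_mult)
    also have "\<dots> = (\<integral>\<^sup>+\<omega>. ennreal V * indicator A \<omega> \<partial>M)"
      using A by (simp add: nn_integral_cmult)
    also have "\<dots> \<le> (\<integral>\<^sup>+\<omega>. \<integral>\<^sup>+y. indicator ?B (\<omega>, y) \<partial>lborel \<partial>M)"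
      using ball by (rule nn_integral_mono)
    also have "\<dots> = (\<integral>\<^sup>+y. \<integral>\<^sup>+\<omega>. indicator ?B (\<omega>, y) \<partial>M \<partial>lborel)"
    proof -
      interpret pair_sigma_finite M "lborel :: (real^'d) measure" ..
      show ?thesis by (rule Fubini'[symmetric]) (use B in simp)
    qed
    also have "\<dots> = (\<integral>\<^sup>+y. emeasure M {\<omega> \<in> space M. \<tau> y \<le> \<bar>kde K X n b \<omega> y - f y\<bar>} \<partial>lborel)"
    proof (rule nn_integral_cong)
      fix y
      have "(\<integral>\<^sup>+\<omega>. indicator ?B (\<omega>, y) \<partial>M) = (\<integral>\<^sup>+\<omega>. indicator {\<omega> \<in> space M. \<tau> y \<le> \<bar>kde K X n b \<omega> y - f y\<bar>} \<omega> \<partial>M)"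
        by (intro nn_integral_cong) (auto simp: indicator_def space_pair_measure)
      then show "(\<integral>\<^sup>+\<omega>. indicator ?B (\<omega>, y) \<partial>M) = emeasure M {\<omega> \<in> space M. \<tau> y \<le> \<bar>kde K X n b \<omega> y - f y\<bar>}"
        by simp
    qed
    also have "\<dots> \<le> (\<integral>\<^sup>+y. ennreal (exp (- E)) * (ennreal D * ennreal (p b y) + ennreal (1 / \<tau>0) * ennreal (f y)) \<partial>lborel)"
      using point by (intro nn_integral_mono) auto
    also have "\<dots> = ennreal (exp (- E)) * (ennreal D * (\<integral>\<^sup>+y. ennreal (p b y) \<partial>lborel) + ennreal (1 / \<tau>0) * (\<integral>\<^sup>+y. ennreal (f y) \<partial>lborel))"
      by (simp add: nn_integral_cmult nn_integral_add)
    also have "\<dots> = ennreal (exp (- E)) * (ennreal D * ennreal (b ^ CARD('d)) + ennreal (1 / \<tau>0))"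
      using nn_integral_p[OF b(1)] nn_integral_eq_integral[OF f_integrable] f_nonneg f_integral by simp
    also have "\<dots> \<le> ennreal (exp (- E)) * (ennreal D * 1 + ennreal (1 / \<tau>0))"
      using b by (intro mult_left_mono add_mono) (auto simp: power_le_one)
    also have "\<dots> = ennreal (exp (- E) * (D + 1 / \<tau>0))"
      using D \<tau>0 by (simp add: ennreal_mult ennreal_plus)
    finally show ?thesis .
  qed
  then have "V * prob A \<le> exp (- E) * (D + 1 / \<tau>0)"
    using D \<tau>0 by (subst (asm) ennreal_le_iff) auto
  then have "prob A \<le> (D + 1 / \<tau>0) * exp (- E) / V"
    using V by (simp add: field_simps)
  then show ?thesis unfolding A_def V_def D_def .
qed

end

section \<open>A logarithmic lower bound for Gaussian moment generating functions\<close>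

text \<open>The lower half of a Gaertner-Ellis bound, without a change of measure. The exponential
  moment with parameter s slightly above \<theta> is carried by values of Z near s: smaller and
  larger values are controlled by the moments with parameters s - \<eta> and s + \<eta>, and strict
  convexity of t^2 / 2 makes their share exponentially smaller. What remains is at most exp (a s (s
  + 2 \<eta>)) times the probability sought.\<close>

lemma (in prob_space) gaussian_mgf_lower_bound:
  fixes Z :: "nat \<Rightarrow> 'a \<Rightarrow> real" and a :: "nat \<Rightarrow> real"
  assumes a: "filterlim a at_top sequentially"
    and Z [measurable]: "\<And>n. Z n \<in> borel_measurable M"
    and int: "\<And>t n. integrable M (\<lambda>\<omega>. exp (t * Z n \<omega>))"
    and lim: "\<And>t. t > 0 \<Longrightarrow> (\<lambda>n. ln (expectation (\<lambda>\<omega>. exp (a n * t * Z n \<omega>))) / a n) \<longlonglongrightarrow> t\<^sup>2 / 2"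
    and \<theta>: "\<theta> > 0" and c: "c > \<theta>\<^sup>2 / 2"
  shows "eventually (\<lambda>n. exp (- c * a n) \<le> prob {\<omega> \<in> space M. \<theta> \<le> Z n \<omega>}) sequentially"
proof -
  \<comment> \<open>With s = \<theta> + 2 \<eta> the expression is s (s + 2 \<eta>) - s^2 / 2, the
    cost of dividing the moment by its largest central value, plus a slack \<eta>^2. It tends to
    \<theta>^2 / 2.\<close>
  have "((\<lambda>\<eta>. (\<theta> + 2 * \<eta>)\<^sup>2 / 2 + 2 * \<eta> * (\<theta> + 2 * \<eta>) + \<eta>\<^sup>2) \<longlongrightarrow>
      (\<theta> + 2 * 0)\<^sup>2 / 2 + 2 * 0 * (\<theta> + 2 * 0) + 0\<^sup>2) (at_right 0)"
    by (intro tendsto_intros) auto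
  then have "eventually (\<lambda>\<eta>. (\<theta> + 2 * \<eta>)\<^sup>2 / 2 + 2 * \<eta> * (\<theta> + 2 * \<eta>) + \<eta>\<^sup>2 < c) (at_right 0)"
    using c by (intro order_tendstoD) auto
  then obtain \<eta> where \<eta>: "\<eta> > 0" "(\<theta> + 2 * \<eta>)\<^sup>2 / 2 + 2 * \<eta> * (\<theta> + 2 * \<eta>) + \<eta>\<^sup>2 < c"
    by (metis (mono_tags, lifting) eventually_at_right_less eventually_conj eventually_happens'
        trivial_limit_at_right_real)
  define s where "s = \<theta> + 2 * \<eta>"
  have s: "s > 0" "s - \<eta> > 0" "s + \<eta> > 0" using \<theta> \<eta> by (auto simp: s_def)
  let ?m = "\<lambda>n t. expectation (\<lambda>\<omega>. exp (a n * t * Z n \<omega>))"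
  have pos: "?m n t > 0" for n t
  proof -
    have "?m n t \<ge> 0" by (rule integral_nonneg_AE) simp
    moreover have "?m n t \<noteq> 0"
      using integral_nonneg_eq_0_iff_AE[OF int[of "a n * t" n]] AE_False by simp
    ultimately show ?thesis by linarith
  qed
  have \<eta>2: "\<eta>\<^sup>2 > 0" using \<eta> by simp
  \<comment> \<open>The condition with 4 makes the two tails together at most half of the moment;
    the condition with 2 absorbs the remaining factor 1/2. Allowing an error \<eta>^2 / 4 in each
    limit reduces the gap between centre and tails from 3 \<eta>^2 / 2 to \<eta>^2.\<close>
  have "eventually (\<lambda>n. a n > 0 \<and> 4 \<le> exp (a n * \<eta>\<^sup>2) \<and> 2 \<le> exp (a n * (3/4 * \<eta>\<^sup>2))
      \<and> s\<^sup>2 / 2 - \<eta>\<^sup>2 / 4 < ln (?m n s) / a n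
      \<and> ln (?m n (s - \<eta>)) / a n < (s - \<eta>)\<^sup>2 / 2 + \<eta>\<^sup>2 / 4
      \<and> ln (?m n (s + \<eta>)) / a n < (s + \<eta>)\<^sup>2 / 2 + \<eta>\<^sup>2 / 4) sequentially"
  proof (intro eventually_conj)
    show "eventually (\<lambda>n. a n > 0) sequentially"
      using a by (simp add: filterlim_at_top_dense)
    have "filterlim (\<lambda>n. exp (a n * \<eta>\<^sup>2)) at_top sequentially"
      using filterlim_compose[OF exp_at_top filterlim_at_top_mult_tendsto_pos[OF tendsto_const \<eta>2 a]] .
    then show "eventually (\<lambda>n. 4 \<le> exp (a n * \<eta>\<^sup>2)) sequentially"
      by (simp only: filterlim_at_top)
    have "0 < 3/4 * \<eta>\<^sup>2" using \<eta>2 by simp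
    then have "filterlim (\<lambda>n. exp (a n * (3/4 * \<eta>\<^sup>2))) at_top sequentially"
      using filterlim_compose[OF exp_at_top filterlim_at_top_mult_tendsto_pos[OF tendsto_const _ a]] by blast
    then show "eventually (\<lambda>n. 2 \<le> exp (a n * (3/4 * \<eta>\<^sup>2))) sequentially"
      by (simp only: filterlim_at_top)
    show "eventually (\<lambda>n. s\<^sup>2 / 2 - \<eta>\<^sup>2 / 4 < ln (?m n s) / a n) sequentially"
      using order_tendstoD(1)[OF lim[OF s(1)], of "s\<^sup>2 / 2 - \<eta>\<^sup>2 / 4"] \<eta>2 by simp
    show "eventually (\<lambda>n. ln (?m n (s - \<eta>)) / a n < (s - \<eta>)\<^sup>2 / 2 + \<eta>\<^sup>2 / 4) sequentially"
      using order_tendstoD(2)[OF lim[OF s(2)], of "(s - \<eta>)\<^sup>2 / 2 + \<eta>\<^sup>2 / 4"] \<eta>2 by simp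
    show "eventually (\<lambda>n. ln (?m n (s + \<eta>)) / a n < (s + \<eta>)\<^sup>2 / 2 + \<eta>\<^sup>2 / 4) sequentially"
      using order_tendstoD(2)[OF lim[OF s(3)], of "(s + \<eta>)\<^sup>2 / 2 + \<eta>\<^sup>2 / 4"] \<eta>2 by simp
  qed
  then show ?thesis
  proof eventually_elim
    case (elim n)
    define A where "A = {\<omega> \<in> space M. \<theta> \<le> Z n \<omega>}"
    define T where "T = exp (a n * (s\<^sup>2 / 2 - \<eta>\<^sup>2 / 4))"
    have A: "A \<in> sets M" unfolding A_def by measurable
    have an: "a n > 0" using elim by simp
    have low: "T \<le> ?m n s"
    proof -
      have "a n * (s\<^sup>2 / 2 - \<eta>\<^sup>2 / 4) < ln (?m n s)"
        using elim by (auto simp: field_simps)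
      then show ?thesis
        unfolding T_def by (metis exp_ln exp_le_cancel_iff less_imp_le pos)
    qed
    have up: "?m n t \<le> exp (a n * (t\<^sup>2 / 2 + \<eta>\<^sup>2 / 4))" if "t = s - \<eta> \<or> t = s + \<eta>" for t
    proof -
      have "ln (?m n t) < a n * (t\<^sup>2 / 2 + \<eta>\<^sup>2 / 4)"
        using elim that by (auto simp: field_simps)
      then show ?thesis
        by (metis exp_ln exp_le_cancel_iff less_imp_le pos)
    qed
    have "?m n s \<le> expectation (\<lambda>\<omega>. exp (a n * \<eta> * \<theta>) * exp (a n * (s - \<eta>) * Z n \<omega>)
        + exp (a n * s * (s + 2 * \<eta>)) * indicator A \<omega>
        + exp (- a n * \<eta> * (s + 2 * \<eta>)) * exp (a n * (s + \<eta>) * Z n \<omega>))"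
    proof (rule integral_mono)
      show "integrable M (\<lambda>\<omega>. exp (a n * \<eta> * \<theta>) * exp (a n * (s - \<eta>) * Z n \<omega>)
        + exp (a n * s * (s + 2 * \<eta>)) * indicator A \<omega>
        + exp (- a n * \<eta> * (s + 2 * \<eta>)) * exp (a n * (s + \<eta>) * Z n \<omega>))"
        using A by (intro Bochner_Integration.integrable_add integrable_mult_right int integrable_real_indicator)
          (auto simp: emeasure_eq_measure)
      fix \<omega> assume \<omega>: "\<omega> \<in> space M"
      let ?z = "Z n \<omega>"
      \<comment> \<open>Below \<theta> the factor exp (a \<eta> Z) is at most exp (a \<eta>
        \<theta>); above s + 2 \<eta> the factor exp (- a \<eta> Z) is at most its value at that
        endpoint. The interval in between is symmetric about s, so both tails obey the same
        bound.\<close>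
      consider "?z < \<theta>" | "\<theta> \<le> ?z" "?z \<le> s + 2 * \<eta>" | "s + 2 * \<eta> < ?z" by linarith
      then show "exp (a n * s * ?z) \<le> exp (a n * \<eta> * \<theta>) * exp (a n * (s - \<eta>) * ?z)
        + exp (a n * s * (s + 2 * \<eta>)) * indicator A \<omega>
        + exp (- a n * \<eta> * (s + 2 * \<eta>)) * exp (a n * (s + \<eta>) * ?z)"
      proof cases
        case 1
        have "a n * s * ?z \<le> a n * \<eta> * \<theta> + a n * (s - \<eta>) * ?z"
          using mult_left_mono[of ?z \<theta> "a n * \<eta>"] 1 an \<eta>(1) by (simp add: algebra_simps)
        then have "exp (a n * s * ?z) \<le> exp (a n * \<eta> * \<theta>) * exp (a n * (s - \<eta>) * ?z)"
          by (simp flip: exp_add)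
        then show ?thesis by (simp add: add_increasing2)
      next
        case 2
        then have "exp (a n * s * ?z) \<le> exp (a n * s * (s + 2 * \<eta>)) * indicator A \<omega>"
          using \<omega> an s(1) by (simp add: A_def)
        then show ?thesis by (simp add: add_increasing add_increasing2)
      next
        case 3
        have "a n * s * ?z \<le> - a n * \<eta> * (s + 2 * \<eta>) + a n * (s + \<eta>) * ?z"
          using mult_left_mono[of "s + 2 * \<eta>" ?z "a n * \<eta>"] 3 an \<eta>(1) by (simp add: algebra_simps)
        then have "exp (a n * s * ?z) \<le> exp (- a n * \<eta> * (s + 2 * \<eta>)) * exp (a n * (s + \<eta>) * ?z)"
          by (simp flip: exp_add)
        then show ?thesis by (simp add: add_increasing)
      qed
    qed (rule int)
    also have "\<dots> = exp (a n * \<eta> * \<theta>) * ?m n (s - \<eta>) + exp (a n * s * (s + 2 * \<eta>)) * prob A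
        + exp (- a n * \<eta> * (s + 2 * \<eta>)) * ?m n (s + \<eta>)"
    proof -
      have "integrable M (indicat_real A)"
        using A by (intro integrable_real_indicator) (auto simp: emeasure_eq_measure)
      then show ?thesis using A int by simp
    qed
    also have "\<dots> \<le> exp (a n * \<eta> * \<theta>) * exp (a n * ((s - \<eta>)\<^sup>2 / 2 + \<eta>\<^sup>2 / 4))
        + exp (a n * s * (s + 2 * \<eta>)) * prob A
        + exp (- a n * \<eta> * (s + 2 * \<eta>)) * exp (a n * ((s + \<eta>)\<^sup>2 / 2 + \<eta>\<^sup>2 / 4))"
      using up by (intro add_mono mult_left_mono) auto
    also have "exp (a n * \<eta> * \<theta>) * exp (a n * ((s - \<eta>)\<^sup>2 / 2 + \<eta>\<^sup>2 / 4)) = T * exp (- a n * \<eta>\<^sup>2)"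
      unfolding T_def exp_add[symmetric] s_def by (simp add: power2_eq_square field_simps)
    also have "exp (- a n * \<eta> * (s + 2 * \<eta>)) * exp (a n * ((s + \<eta>)\<^sup>2 / 2 + \<eta>\<^sup>2 / 4)) = T * exp (- a n * \<eta>\<^sup>2)"
      unfolding T_def exp_add[symmetric] by (simp add: power2_eq_square field_simps)
    finally have "T \<le> 2 * T * exp (- a n * \<eta>\<^sup>2) + exp (a n * s * (s + 2 * \<eta>)) * prob A"
      using low by simp
    moreover have "2 * T * exp (- a n * \<eta>\<^sup>2) \<le> 2 * T * (1 / 4)"
      using elim by (intro mult_left_mono) (auto simp: T_def exp_minus field_simps)
    ultimately have "T / 2 \<le> exp (a n * s * (s + 2 * \<eta>)) * prob A" by simp
    then have "T / 2 / exp (a n * s * (s + 2 * \<eta>)) \<le> prob A"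
      by (subst pos_divide_le_eq) (auto simp: mult.commute)
    then have "T / 2 * exp (- (a n * s * (s + 2 * \<eta>))) \<le> prob A"
      by (simp only: exp_minus divide_inverse)
    moreover have "exp (- c * a n) \<le> T / 2 * exp (- (a n * s * (s + 2 * \<eta>)))"
    proof -
      have "exp (- c * a n) \<le> exp (a n * (- (s\<^sup>2 / 2 + 2 * \<eta> * s + \<eta>\<^sup>2)))"
        using mult_left_mono[OF less_imp_le[OF \<eta>(2)], of "a n"] an
        by (simp add: s_def algebra_simps)
      also have "\<dots> = T * exp (- (a n * s * (s + 2 * \<eta>))) * exp (- (a n * (3/4 * \<eta>\<^sup>2)))"
        unfolding T_def exp_add[symmetric] by (simp add: power2_eq_square field_simps)
      also have "\<dots> \<le> T * exp (- (a n * s * (s + 2 * \<eta>))) * (1 / 2)"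
        using elim by (intro mult_left_mono) (auto simp: T_def exp_minus field_simps)
      finally show ?thesis by simp
    qed
    ultimately show ?case unfolding A_def by simp
  qed
qed

section \<open>The exponential rate\<close>

locale bandwidths =
  fixes d :: nat and h hs v \<epsilon> :: "nat \<Rightarrow> real"
  assumes d_pos: "d > 0"
    and h_pos: "\<And>n. n \<ge> 1 \<Longrightarrow> h n > 0" and h_lim: "h \<longlonglongrightarrow> 0"
    and hs_pos: "\<And>n. n \<ge> 1 \<Longrightarrow> hs n > 0" and hs_lim: "hs \<longlonglongrightarrow> 0"
    and v_pos: "\<And>n. n \<ge> 1 \<Longrightarrow> v n > 0" and v_lim: "filterlim v at_top sequentially"
    and eps_pos: "\<And>n. n \<ge> 1 \<Longrightarrow> \<epsilon> n > 0" and eps_lim: "\<epsilon> \<longlonglongrightarrow> 0"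
    and hs_eps: "(\<lambda>n. hs n / \<epsilon> n) \<longlonglongrightarrow> 0"
    and h_eps: "(\<lambda>n. (h n)\<^sup>2 / \<epsilon> n) \<longlonglongrightarrow> 0"
    and v_eps: "filterlim (\<lambda>n. v n * \<epsilon> n powr (3/2)) at_top sequentially"
    and v_hs: "(\<lambda>n. v n * (hs n)\<^sup>2 / sqrt (\<epsilon> n)) \<longlonglongrightarrow> 0"
    and rate_log: "filterlim (\<lambda>n. real n * hs n ^ d / ((v n)\<^sup>2 * ln (1 / hs n))) at_top sequentially"
    and h_hs: "filterlim (\<lambda>n. (v n)\<^sup>2 * h n ^ d * (\<epsilon> n)\<^sup>2 / hs n ^ d) at_top sequentially"
begin

definition rate :: "nat \<Rightarrow> real" where "rate n = real n * hs n ^ d / (v n)\<^sup>2"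

lemma eventually_ge_1: "eventually (\<lambda>n::nat. n \<ge> 1) sequentially"
  by (rule eventually_ge_at_top)

lemma small: "X \<longlonglongrightarrow> 0 \<Longrightarrow> r > 0 \<Longrightarrow> eventually (\<lambda>n. X n \<le> r) sequentially" for X :: "nat \<Rightarrow> real"
  using order_tendstoD(2)[of X 0 sequentially r] by (auto elim: eventually_mono)

lemma power_le_power:
  assumes "r > 0" shows "eventually (\<lambda>n. A / real n ^ Suc k \<le> r / real n ^ k) sequentially"
  using eventually_ge_at_top[of "nat \<lceil>A / r\<rceil>"] eventually_ge_1
proof eventually_elim
  case (elim n)
  then have "A / r \<le> real n" by linarith
  then have "A \<le> r * real n" using assms by (simp add: field_simps)
  then have "A / real n \<le> r" using elim by (simp add: field_simps)
  then have "A / real n / real n ^ k \<le> r / real n ^ k" by (rule divide_right_mono) simp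
  then show ?case by simp
qed

lemma ln_hs: "filterlim (\<lambda>n. ln (1 / hs n)) at_top sequentially"
proof -
  have "eventually (\<lambda>n. hs n > 0) sequentially"
    using eventually_ge_1 by eventually_elim (rule hs_pos)
  then have "filterlim (\<lambda>n. inverse (hs n)) at_top sequentially"
    using hs_lim filterlim_inverse_at_top by blast
  then show ?thesis
    using filterlim_compose[OF ln_at_top] by (simp add: inverse_eq_divide)
qed

lemma rate_ge_log: "eventually (\<lambda>n. Z * ln (1 / hs n) \<le> rate n) sequentially"
proof -
  have "eventually (\<lambda>n. Z \<le> real n * hs n ^ d / ((v n)\<^sup>2 * ln (1 / hs n))) sequentially"
    using rate_log by (simp only: filterlim_at_top)
  moreover have "eventually (\<lambda>n. 1 \<le> ln (1 / hs n)) sequentially"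
    using ln_hs by (simp only: filterlim_at_top)
  ultimately show ?thesis
  proof eventually_elim
    case (elim n)
    have "Z \<le> rate n / ln (1 / hs n)"
      using elim(1) by (simp add: rate_def)
    then show ?case
      using elim(2) by (subst (asm) pos_le_divide_eq) linarith+
  qed
qed

lemma rate_at_top: "filterlim rate at_top sequentially"
  unfolding filterlim_at_top
proof
  fix Z :: real
  have "eventually (\<lambda>n. 1 \<le> ln (1 / hs n)) sequentially"
    using ln_hs by (simp only: filterlim_at_top)
  with rate_ge_log[of "\<bar>Z\<bar>"] show "eventually (\<lambda>n. Z \<le> rate n) sequentially"
  proof eventually_elim
    case (elim n)
    have "Z \<le> \<bar>Z\<bar> * 1" by simp
    also have "\<dots> \<le> \<bar>Z\<bar> * ln (1 / hs n)" using elim by (intro mult_left_mono) auto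
    finally show ?case using elim by linarith
  qed
qed

text \<open>Makes perturbations and prefactors polynomial in n. From rate >= 1, that is v^2 <= n
  hs^d, follow v <= n and hs^d >= 1 / n; then v eps^(3/2) >= 1 gives eps >= 1 / n, and
  \<open>h_hs\<close> bounds h^d from below.\<close>

lemma crude_bounds:
  "eventually (\<lambda>n. n \<ge> 1 \<and> 0 < h n \<and> h n \<le> 1 \<and> 0 < hs n \<and> hs n \<le> 1 \<and> 0 < \<epsilon> n \<and> \<epsilon> n \<le> 1
     \<and> 1 \<le> v n \<and> v n \<le> real n \<and> 1 / real n ^ 2 \<le> hs n ^ d \<and> 1 / real n ^ 2 \<le> h n ^ d
     \<and> 1 / real n \<le> \<epsilon> n) sequentially"
proof -
  have "eventually (\<lambda>n. 1 \<le> v n) sequentially"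
    using v_lim by (simp only: filterlim_at_top)
  moreover have "eventually (\<lambda>n. 1 \<le> rate n) sequentially"
    using rate_at_top by (simp only: filterlim_at_top)
  moreover have "eventually (\<lambda>n. 1 \<le> v n * \<epsilon> n powr (3/2)) sequentially"
    using v_eps by (simp only: filterlim_at_top)
  moreover have "eventually (\<lambda>n. 1 \<le> (v n)\<^sup>2 * h n ^ d * (\<epsilon> n)\<^sup>2 / hs n ^ d) sequentially"
    using h_hs by (simp only: filterlim_at_top)
  ultimately show ?thesis
    using eventually_ge_1 small[OF h_lim zero_less_one] small[OF hs_lim zero_less_one] small[OF eps_lim zero_less_one]
  proof eventually_elim
    case (elim n)
    have pos: "h n > 0" "hs n > 0" "\<epsilon> n > 0" "v n > 0" and n: "real n \<ge> 1"
      using h_pos hs_pos eps_pos v_pos \<open>n \<ge> 1\<close> by auto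
    have hsd: "hs n ^ d > 0" "hs n ^ d \<le> 1" using pos elim by (auto simp: power_le_one)
    have v2: "(v n)\<^sup>2 \<le> real n * hs n ^ d"
      using elim(2) pos by (simp add: rate_def field_simps)
    have v2n: "(v n)\<^sup>2 \<le> real n"
      using v2 mult_left_mono[OF hsd(2), of "real n"] by simp
    have "v n * 1 \<le> v n * v n" using elim by (intro mult_left_mono) auto
    then have vn: "v n \<le> real n" using v2n by (simp add: power2_eq_square)
    have "1 \<le> (v n)\<^sup>2" using elim by simp
    then have hs1: "1 / real n \<le> hs n ^ d"
      using v2 n by (simp add: field_simps)
    have "1 / real n ^ 2 \<le> 1 / real n"
      using n by (simp add: power2_eq_square field_simps)
    with hs1 have hs2: "1 / real n ^ 2 \<le> hs n ^ d" by linarith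
    have e1: "1 / real n \<le> \<epsilon> n"
    proof -
      have "\<epsilon> n powr (3/2) \<le> \<epsilon> n powr 1"
        using pos elim by (intro powr_mono') auto
      then have "v n * \<epsilon> n powr (3/2) \<le> real n * \<epsilon> n"
        using pos vn by (intro mult_mono) auto
      then show ?thesis using elim n by (simp add: field_simps)
    qed
    have h2: "1 / real n ^ 2 \<le> h n ^ d"
    proof -
      have "hs n ^ d \<le> (v n)\<^sup>2 * h n ^ d * (\<epsilon> n)\<^sup>2"
        using elim hsd by (simp add: field_simps)
      also have "\<dots> \<le> real n * h n ^ d * 1"
        using v2n pos elim by (intro mult_mono) (auto simp: power_le_one)
      finally have "1 / real n \<le> real n * h n ^ d" using hs1 by simp
      then show ?thesis using n by (simp add: field_simps power2_eq_square)
    qed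
    show ?case using elim pos vn hs2 e1 h2 by auto
  qed
qed

text \<open>If \<open>hs\<close> decays fast then \<open>ln n\<close> is of the order of \<open>ln (1 / hs n)\<close>; if it decays slowly then
  the bias condition \<open>v_hs\<close> bounds \<open>v\<close> and makes the rate at least \<open>sqrt n\<close>.\<close>

lemma ln_le_rate:
  assumes "\<eta> > 0" shows "eventually (\<lambda>n. ln (real n) \<le> \<eta> * rate n) sequentially"
proof -
  \<comment> \<open>In the fast case ln n <= 2 (d + 4) ln (1 / hs), and this Z makes \<eta> Z ln (1
    / hs) equal to that bound.\<close>
  define Z where "Z = 2 * (real d + 4) / \<eta>"
  have "eventually (\<lambda>n. ln (real n) \<le> \<eta> * sqrt (real n)) sequentially"
    using assms by real_asymp
  then show ?thesis
    using small[OF v_hs zero_less_one] crude_bounds rate_ge_log[of Z]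
  proof eventually_elim
    case (elim n)
    have pos: "hs n > 0" "\<epsilon> n > 0" "v n > 0" and n: "real n \<ge> 1" using elim by auto
    have hsd: "hs n ^ (d + 4) > 0" using pos by simp
    show ?case
    \<comment> \<open>The exponent is d + 4 because \<open>v_hs\<close> and eps <= 1 give v^2 hs^4
      <= 1, hence rate >= n hs^(d + 4).\<close>
    proof (cases "1 / sqrt (real n) \<le> hs n ^ (d + 4)")
      case True
      have "v n * (hs n)\<^sup>2 \<le> sqrt (\<epsilon> n)" using elim pos by (simp add: field_simps)
      also have "\<dots> \<le> 1" using elim by simp
      finally have "(v n * (hs n)\<^sup>2)\<^sup>2 \<le> 1" using pos by (intro power_le_one) auto
      then have v2: "(v n)\<^sup>2 * hs n ^ 4 \<le> 1" by (simp add: power_mult_distrib flip: power_mult)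
      have "sqrt (real n) = real n * (1 / sqrt (real n))"
        using n by (simp add: real_div_sqrt)
      also have "\<dots> \<le> real n * hs n ^ (d + 4)" using True by (intro mult_left_mono) auto
      finally have "sqrt (real n) * (v n)\<^sup>2 \<le> real n * hs n ^ (d + 4) * (v n)\<^sup>2"
        by (intro mult_right_mono) auto
      also have "\<dots> \<le> real n * hs n ^ d"
        using mult_left_mono[OF v2, of "real n * hs n ^ d"] pos by (simp add: power_add mult_ac)
      finally have "sqrt (real n) \<le> rate n"
        using pos by (simp add: rate_def pos_le_divide_eq)
      then show ?thesis using elim assms by (meson mult_left_mono less_imp_le order_trans)
    next
      case False
      then have "hs n ^ (d + 4) \<le> 1 / sqrt (real n)" by simp
      then have "sqrt (real n) \<le> (1 / hs n) ^ (d + 4)"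
        using n pos by (simp add: field_simps)
      then have "ln (sqrt (real n)) \<le> ln ((1 / hs n) ^ (d + 4))"
        using n pos by (subst ln_le_cancel_iff) auto
      then have "ln (real n) / 2 \<le> (real d + 4) * ln (1 / hs n)"
        using n pos by (simp add: ln_sqrt ln_realpow)
      moreover have "\<eta> * (Z * ln (1 / hs n)) \<le> \<eta> * rate n"
        using elim assms by (intro mult_left_mono) auto
      moreover have "\<eta> * (Z * ln (1 / hs n)) = 2 * ((real d + 4) * ln (1 / hs n))"
        using assms by (simp add: Z_def)
      ultimately show ?thesis by linarith
    qed
  qed
qed

text \<open>One extra power of n swallows the constant c. The case k = 0 is how constant factors
  such as 2 are absorbed later.\<close>

lemma poly_le_exp_rate:
  assumes "\<eta> > 0" shows "eventually (\<lambda>n. c * real n ^ k \<le> exp (\<eta> * rate n)) sequentially"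
proof -
  have "\<eta> / (real k + 1) > 0" using assms by simp
  from ln_le_rate[OF this] eventually_ge_1 eventually_ge_at_top[of "nat \<lceil>c\<rceil>"]
  show ?thesis
  proof eventually_elim
    case (elim n)
    have c: "c \<le> real n" using elim(3) by linarith
    have n: "real n > 0" using elim by simp
    have "c * real n ^ k \<le> real n ^ (k + 1)"
      using mult_right_mono[OF c, of "real n ^ k"] by simp
    also have "\<dots> = exp ((real k + 1) * ln (real n))"
      using n by (simp add: exp_of_nat_mult[symmetric] exp_add distrib_right) (simp add: exp_of_nat_mult)
    also have "\<dots> \<le> exp (\<eta> * rate n)"
      using elim assms by (simp add: field_simps)
    finally show ?case .
  qed
qed

text \<open>The numerator is the order of the Chernoff exponent for deviations of f_n by a multiple
  of eps, so this exponent outgrows every multiple of \<open>rate\<close>.\<close>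

lemma pilot_rate: "filterlim (\<lambda>n. real n * h n ^ d * (\<epsilon> n)\<^sup>2 / rate n) at_top sequentially"
proof (rule filterlim_mono_eventually[OF h_hs order_refl order_refl])
  show "eventually (\<lambda>n. (v n)\<^sup>2 * h n ^ d * (\<epsilon> n)\<^sup>2 / hs n ^ d = real n * h n ^ d * (\<epsilon> n)\<^sup>2 / rate n) sequentially"
    using crude_bounds by eventually_elim (auto simp: rate_def field_simps)
qed

lemma v_sqrt_eps: "filterlim (\<lambda>n. v n * sqrt (\<epsilon> n)) at_top sequentially"
proof (rule filterlim_at_top_mono[OF v_eps])
  show "eventually (\<lambda>n. v n * \<epsilon> n powr (3/2) \<le> v n * sqrt (\<epsilon> n)) sequentially"
    using crude_bounds
  proof eventually_elim
    case (elim n)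
    then have "\<epsilon> n powr (3/2) \<le> \<epsilon> n powr (1/2)" by (intro powr_mono') auto
    then show ?case using elim by (simp add: powr_half_sqrt)
  qed
qed

end

section \<open>Exponential asymptotics of the exceedance probability\<close>

locale kde_asymptotics = kde_model M X f K grad G H fmax Kmax L \<alpha> + bandwidths "CARD('d)" h hs v \<epsilon>
  for M :: "'w measure" and X :: "nat \<Rightarrow> 'w \<Rightarrow> real^'d" and f K :: "real^'d \<Rightarrow> real"
    and grad :: "real^'d \<Rightarrow> real^'d" and G H fmax Kmax L \<alpha> :: real and h hs v \<epsilon> :: "nat \<Rightarrow> real"
begin

section \<open>Uniform upper bounds for both estimators\<close>

text \<open>One radius n^-B has to serve all bandwidths with b^d >= n^-2. Dividing by b^d costs at
  most n^2, so the Hoelder power must be at most n^-6, whence m >= 6 / \<alpha>. Dividing by b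
  inside the power costs another n^2, covered by the 4 in B = 4 + m, which also settles the
  Lipschitz term.\<close>

lemma perturbation_small:
  "\<exists>B :: nat. (\<forall>n b. n \<ge> 1 \<longrightarrow> 0 < b \<longrightarrow> b \<le> 1 \<longrightarrow> 1 / real n ^ 2 \<le> b ^ CARD('d)
      \<longrightarrow> L * (1 / real n ^ B / b) powr \<alpha> / b ^ CARD('d) \<le> L / real n ^ 4)
    \<and> (\<forall>n\<ge>1. G * (1 / real n ^ B) \<le> G / real n ^ 4)"
proof -
  define m where "m = nat \<lceil>6 / \<alpha>\<rceil>"
  have m: "6 \<le> real m * \<alpha>"
  proof -
    have "6 / \<alpha> \<le> real m" unfolding m_def by linarith
    then show ?thesis using \<alpha>_pos by (simp add: field_simps)
  qed
  define B where "B = 4 + m"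
  have drift: "G * (1 / real n ^ B) \<le> G / real n ^ 4" if "n \<ge> 1" for n
    using that G_nonneg unfolding B_def
    by (simp add: divide_left_mono power_add mult_le_cancel_left1)
  have "L * (1 / real n ^ B / b) powr \<alpha> / b ^ CARD('d) \<le> L / real n ^ 4"
    if n: "n \<ge> 1" and b: "0 < b" "b \<le> 1" and bd: "1 / real n ^ 2 \<le> b ^ CARD('d)" for n b
  proof -
  have n': "real n \<ge> 1" using n by simp
  have "b ^ CARD('d) \<le> b"
    using power_decreasing[of 1 "CARD('d)" b] b by simp
  then have bn: "1 / b \<le> real n ^ 2"
  proof -
    have "1 / real n ^ 2 \<le> b" using bd \<open>b ^ CARD('d) \<le> b\<close> by linarith
    then show ?thesis using b n' by (simp add: divide_le_eq mult.commute)
  qed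
  have "1 / real n ^ B / b \<le> 1 / real n ^ B * real n ^ 2"
    using mult_left_mono[OF bn, of "1 / real n ^ B"] by simp
  also have "\<dots> \<le> 1 / real n ^ m"
  proof -
    have "real n ^ 2 * real n ^ m \<le> real n ^ B"
      unfolding B_def power_add[symmetric] using n' by (intro power_increasing) auto
    then show ?thesis using n' by (simp add: divide_le_eq le_divide_eq)
  qed
  also have "\<dots> = real n powr (- real m)"
    using n' by (simp add: powr_minus powr_realpow divide_inverse)
  finally have "(1 / real n ^ B / b) powr \<alpha> \<le> (real n powr (- real m)) powr \<alpha>"
    using b n' \<alpha>_pos by (intro powr_mono2) auto
  also have "\<dots> = real n powr (- (real m * \<alpha>))" by (simp add: powr_powr)
  also have "\<dots> \<le> real n powr (- 6)" using n' m by (intro powr_mono) auto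
  also have "\<dots> = 1 / real n ^ 6" using n' by (simp add: powr_minus powr_numeral divide_inverse)
  finally have p6: "(1 / real n ^ B / b) powr \<alpha> \<le> 1 / real n ^ 6" .
  have "1 / b ^ CARD('d) \<le> real n ^ 2"
    using bd b n' by (simp add: field_simps)
  then have "(1 / real n ^ B / b) powr \<alpha> * (1 / b ^ CARD('d)) \<le> 1 / real n ^ 6 * real n ^ 2"
    using p6 b by (intro mult_mono) auto
  also have "\<dots> = 1 / real n ^ 4"
    using n' by (simp add: field_simps flip: power_add)
  finally have "L * ((1 / real n ^ B / b) powr \<alpha> * (1 / b ^ CARD('d))) \<le> L * (1 / real n ^ 4)"
    using L_nonneg by (intro mult_left_mono)
  then show ?thesis by simp
  qed
  with drift show ?thesis by blast
qed

lemma pilot_uniform: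
  assumes "\<eta> > 0"
  shows "eventually (\<lambda>n. prob {\<omega> \<in> space M. \<exists>x. \<eta> * \<epsilon> n < \<bar>kde K X n (h n) \<omega> x - f x\<bar>}
    \<le> exp (- c * rate n)) sequentially"
proof -
  obtain B where B: "\<And>n b. n \<ge> 1 \<Longrightarrow> 0 < b \<Longrightarrow> b \<le> 1 \<Longrightarrow> 1 / real n ^ 2 \<le> b ^ CARD('d)
      \<Longrightarrow> L * (1 / real n ^ B / b) powr \<alpha> / b ^ CARD('d) \<le> L / real n ^ 4"
    "\<And>n. n \<ge> 1 \<Longrightarrow> G * (1 / real n ^ B) \<le> G / real n ^ 4"
    using perturbation_small by blast
  define J where "J = (\<kappa> * fmax + C) * exp Kmax"
  have J: "J \<ge> 0" unfolding J_def using \<kappa>_pos fmax_nonneg C_nonneg by simp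
  \<comment> \<open>Half of \<eta> eps is left for the perturbation inside a ball. With parameter u
    eps and deviation \<eta> eps / 2, the exponent in units of N u \<eta> eps^2 is at most 1/8
    (bias) + 1/16 (quadratic term) - 1/2, hence below -1/4. No optimisation of u is attempted, as
    \<open>pilot_rate\<close> leaves an unbounded factor to spare.\<close>
  define u where "u = min 1 (\<eta> / 8 / (J + 1))"
  have u: "0 < u" "u \<le> 1" using assms J by (auto simp: u_def)
  have uJ: "u * J \<le> \<eta> / 8"
  proof -
    have "u \<le> \<eta> / 8 / (J + 1)" by (simp add: u_def)
    then have "u * (J + 1) \<le> \<eta> / 8" using J by (subst (asm) pos_le_divide_eq) auto
    then show ?thesis using u by (simp add: distrib_left)
  qed
  define V where "V = unit_ball_vol (CARD('d))"
  have V: "V > 0" unfolding V_def by simp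
  define W where "W = (2 * exp Kmax + 2 / \<eta>) / V"
  have "(\<lambda>n. C * ((h n)\<^sup>2 / \<epsilon> n)) \<longlonglongrightarrow> 0" using tendsto_mult_right_zero[OF h_eps] .
  then have "eventually (\<lambda>n. C * ((h n)\<^sup>2 / \<epsilon> n) \<le> \<eta> / 8) sequentially"
    using assms by (intro small) auto
  \<comment> \<open>Of the exponent (|c| + 1) * rate, one unit of \<open>rate\<close> pays for the
    polynomial prefactor.\<close>
  moreover have "eventually (\<lambda>n. 4 * (\<bar>c\<bar> + 1) / (u * \<eta>) \<le> real n * h n ^ CARD('d) * (\<epsilon> n)\<^sup>2 / rate n) sequentially"
    using pilot_rate by (simp only: filterlim_at_top)
  moreover have "eventually (\<lambda>n. 1 \<le> rate n) sequentially"
    using rate_at_top by (simp only: filterlim_at_top)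
  moreover have "eventually (\<lambda>n. (L + G) / real n ^ Suc 3 \<le> \<eta> / 2 / real n ^ 3) sequentially"
    using assms by (intro power_le_power) simp
  moreover have "eventually (\<lambda>n. W * real n ^ (1 + B * CARD('d)) \<le> exp (1 * rate n)) sequentially"
    by (rule poly_le_exp_rate) simp
  ultimately show ?thesis
    using crude_bounds
  proof eventually_elim
    case (elim n)
    have n: "n \<ge> 1" "real n \<ge> 1" and b: "0 < h n" "h n \<le> 1" and e: "0 < \<epsilon> n" "\<epsilon> n \<le> 1"
      and ne: "1 / real n \<le> \<epsilon> n" using elim by auto
    define N where "N = real n * h n ^ CARD('d)"
    have N: "N > 0" using n b by (simp add: N_def)
    have E: "(\<bar>c\<bar> + 1) * rate n \<le> u * \<eta> / 4 * (N * (\<epsilon> n)\<^sup>2)"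
      using elim(2) elim(3) u assms by (simp add: N_def field_simps)
    have E1: "1 \<le> u * \<eta> / 4 * (N * (\<epsilon> n)\<^sup>2)"
      using E mult_mono[of 1 "\<bar>c\<bar> + 1" 1 "rate n"] elim(3) by simp
    have se: "u * \<epsilon> n \<le> 1" using mult_mono[of u 1 "\<epsilon> n" 1] u e by simp
    have "prob {\<omega> \<in> space M. \<exists>x. \<eta> * \<epsilon> n < \<bar>kde K X n (h n) \<omega> x - f x\<bar>}
      \<le> (2 * exp Kmax * real n + 1 / (\<eta> / 2 * \<epsilon> n)) * exp (- (u * \<eta> / 4 * (N * (\<epsilon> n)\<^sup>2)))
        / (unit_ball_vol (CARD('d)) * (1 / real n ^ B) ^ CARD('d))"
    proof (rule uniform_deviation[where s="\<lambda>_. u * \<epsilon> n" and \<tau>="\<lambda>_. \<eta> / 2 * \<epsilon> n", OF n(1) b _ N_def])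
      show "1 \<le> u * \<epsilon> n * N * (\<eta> / 2 * \<epsilon> n)"
        using E1 by (simp add: power2_eq_square mult_ac)
      fix y :: "real^'d"
      have fy: "(u * \<epsilon> n)\<^sup>2 / 2 * exp (u * \<epsilon> n * Kmax) * (\<kappa> * f y + C * h n) \<le> (u * \<epsilon> n)\<^sup>2 / 2 * J"
        unfolding J_def mult.assoc
      proof (intro mult_left_mono)
        have "exp (u * (\<epsilon> n * Kmax)) * (\<kappa> * f y + C * h n) \<le> exp (1 * Kmax) * (\<kappa> * fmax + C * 1)"
          using \<kappa>_pos f_nonneg[of y] f_le[of y] C_nonneg b se Kmax_pos mult_right_mono[OF se, of Kmax]
          by (intro mult_mono add_mono) (auto simp: mult_ac)
        then show "exp (u * (\<epsilon> n * Kmax)) * (\<kappa> * f y + C * h n) \<le> (\<kappa> * fmax + C) * exp Kmax"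
          by (simp add: mult.commute)
      qed auto
      have hC: "u * \<epsilon> n * (C * (h n)\<^sup>2) \<le> u * (\<epsilon> n)\<^sup>2 * (\<eta> / 8)"
      proof -
        have "C * (h n)\<^sup>2 \<le> \<eta> / 8 * \<epsilon> n"
          using elim(1) e by (simp add: field_simps)
        then have "u * \<epsilon> n * (C * (h n)\<^sup>2) \<le> u * \<epsilon> n * (\<eta> / 8 * \<epsilon> n)"
          using u e by (intro mult_left_mono) auto
        then show ?thesis by (simp add: power2_eq_square mult_ac)
      qed
      have "(u * \<epsilon> n)\<^sup>2 / 2 * J = u * (\<epsilon> n)\<^sup>2 / 2 * (u * J)" by (simp add: power2_eq_square)
      also have "\<dots> \<le> u * (\<epsilon> n)\<^sup>2 / 2 * (\<eta> / 8)"
        using u by (intro mult_left_mono uJ) auto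
      finally have "u * \<epsilon> n * (C * (h n)\<^sup>2) + (u * \<epsilon> n)\<^sup>2 / 2 * exp (u * \<epsilon> n * Kmax) * (\<kappa> * f y + C * h n)
          - u * \<epsilon> n * (\<eta> / 2 * \<epsilon> n) \<le> u * (\<epsilon> n)\<^sup>2 * (\<eta> / 8) + u * (\<epsilon> n)\<^sup>2 / 2 * (\<eta> / 8) - u * \<epsilon> n * (\<eta> / 2 * \<epsilon> n)"
        using hC fy by linarith
      also have "\<dots> \<le> - (u * \<eta> / 4 * (\<epsilon> n)\<^sup>2)"
        using u assms by (simp add: power2_eq_square field_simps)
      finally have "N * (u * \<epsilon> n * (C * (h n)\<^sup>2) + (u * \<epsilon> n)\<^sup>2 / 2 * exp (u * \<epsilon> n * Kmax) * (\<kappa> * f y + C * h n)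
          - u * \<epsilon> n * (\<eta> / 2 * \<epsilon> n)) \<le> N * - (u * \<eta> / 4 * (\<epsilon> n)\<^sup>2)"
        using N by (intro mult_left_mono) auto
      also have "\<dots> = - (u * \<eta> / 4 * (N * (\<epsilon> n)\<^sup>2))" by simp
      finally show "N * (u * \<epsilon> n * (C * (h n)\<^sup>2) + (u * \<epsilon> n)\<^sup>2 / 2 * exp (u * \<epsilon> n * Kmax) * (\<kappa> * f y + C * h n)
          - u * \<epsilon> n * (\<eta> / 2 * \<epsilon> n)) \<le> - (u * \<eta> / 4 * (N * (\<epsilon> n)\<^sup>2))" .
      have "\<eta> / 2 * (1 / real n) \<le> \<eta> / 2 * \<epsilon> n" using assms ne by (intro mult_left_mono) auto
      moreover have "\<eta> / 2 / real n ^ 3 \<le> \<eta> / 2 * (1 / real n)"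
        using assms n by (simp add: divide_left_mono self_le_power)
      moreover have "L / real n ^ 4 + G / real n ^ 4 \<le> \<eta> / 2 / real n ^ 3"
        using elim(4) by (simp add: add_divide_distrib eval_nat_numeral)
      moreover have "L * (1 / real n ^ B / h n) powr \<alpha> / h n ^ CARD('d) \<le> L / real n ^ 4"
        using B(1) n(1) b elim(6) by blast
      moreover have "G * (1 / real n ^ B) \<le> G / real n ^ 4" using B(2) n(1) by blast
      moreover have "\<eta> / 2 * \<epsilon> n + \<eta> / 2 * \<epsilon> n = \<eta> * \<epsilon> n" by simp
      ultimately show "\<eta> / 2 * \<epsilon> n + L * (1 / real n ^ B / h n) powr \<alpha> / h n ^ CARD('d) + G * (1 / real n ^ B) \<le> \<eta> * \<epsilon> n"
        by linarith
    qed (use assms e u se n in auto)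
    also have "\<dots> \<le> (2 * exp Kmax * real n + 2 / \<eta> * real n) * exp (- ((\<bar>c\<bar> + 1) * rate n))
        / (unit_ball_vol (CARD('d)) * (1 / real n ^ B) ^ CARD('d))"
    proof (intro divide_right_mono mult_mono add_left_mono)
      have "1 / \<epsilon> n \<le> real n" using ne n e by (simp add: field_simps)
      then show "1 / (\<eta> / 2 * \<epsilon> n) \<le> 2 / \<eta> * real n"
        using mult_left_mono[of "1 / \<epsilon> n" "real n" "2 / \<eta>"] assms by simp
    qed (use E assms n in \<open>auto intro!: mult_nonneg_nonneg\<close>)
    also have "\<dots> = W * real n ^ (1 + B * CARD('d)) * exp (- ((\<bar>c\<bar> + 1) * rate n))"
      using n V by (simp add: W_def V_def[symmetric] power_add power_mult power_divide field_simps)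
    also have "\<dots> \<le> exp (1 * rate n) * exp (- ((\<bar>c\<bar> + 1) * rate n))"
      using elim by (intro mult_right_mono) auto
    also have "\<dots> = exp (- (\<bar>c\<bar> * rate n))"
      by (simp flip: exp_add) (simp add: algebra_simps)
    also have "\<dots> \<le> exp (- c * rate n)"
      using elim(3) mult_right_mono[of c "\<bar>c\<bar>" "rate n"] by simp
    finally show ?case .
  qed
qed

text \<open>Two strict gaps provide the room: the one between \<theta> and \<theta>' absorbs the
  perturbation inside a ball, the one between c and \<theta>^2 / 2 absorbs the polynomial
  prefactor.\<close>

lemma main_uniform:
  assumes \<theta>: "0 < \<theta>" "\<theta> < \<theta>'" and c: "c < \<theta>\<^sup>2 / 2"
  shows "eventually (\<lambda>n. prob {\<omega> \<in> space M. \<exists>x. \<theta>' * sqrt (\<kappa> * max (f x) (\<epsilon> n)) / v n < \<bar>kde K X n (hs n) \<omega> x - f x\<bar>}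
    \<le> exp (- c * rate n)) sequentially"
proof -
  obtain B where B: "\<And>n b. n \<ge> 1 \<Longrightarrow> 0 < b \<Longrightarrow> b \<le> 1 \<Longrightarrow> 1 / real n ^ 2 \<le> b ^ CARD('d)
      \<Longrightarrow> L * (1 / real n ^ B / b) powr \<alpha> / b ^ CARD('d) \<le> L / real n ^ 4"
    "\<And>n. n \<ge> 1 \<Longrightarrow> G * (1 / real n ^ B) \<le> G / real n ^ 4"
    using perturbation_small by blast
  define k where "k = sqrt \<kappa>"
  have k: "k > 0" "k\<^sup>2 = \<kappa>" using \<kappa>_pos by (auto simp: k_def)
  define c' where "c' = (c + \<theta>\<^sup>2 / 2) / 2"
  have c': "c < c'" "c' < \<theta>\<^sup>2 / 2" using c by (auto simp: c'_def)
  define V where "V = unit_ball_vol (CARD('d))"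
  have V: "V > 0" unfolding V_def by simp
  define W where "W = (2 * exp Kmax + 1 / (\<theta> * k)) / V"
  \<comment> \<open>A common upper bound for the parameters \<open>?s\<close>, obtained by replacing
    max (f x) eps with eps.\<close>
  define \<sigma> where "\<sigma> n = \<theta> / (v n * (k * sqrt (\<epsilon> n)))" for n
  \<comment> \<open>v^2 times a bound, uniform in the point, for the exponent per unit of N: bias,
    quadratic term and gain. Its limit is 0 + \<theta>^2 / 2 - \<theta>^2.\<close>
  define Q where "Q n = \<theta> * C / k * (v n * (hs n)\<^sup>2 / sqrt (\<epsilon> n))
      + \<theta>\<^sup>2 / 2 * exp (\<sigma> n * Kmax) * (1 + C / \<kappa> * (hs n / \<epsilon> n)) - \<theta>\<^sup>2" for n
  have \<sigma>0: "\<sigma> \<longlonglongrightarrow> 0"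
  proof -
    have "(\<lambda>n. \<theta> / k * inverse (v n * sqrt (\<epsilon> n))) \<longlonglongrightarrow> 0"
      by (intro tendsto_mult_right_zero tendsto_inverse_0_at_top v_sqrt_eps)
    then show ?thesis by (simp add: \<sigma>_def[abs_def] divide_inverse mult_ac)
  qed
  have "Q \<longlonglongrightarrow> \<theta> * C / k * 0 + \<theta>\<^sup>2 / 2 * exp (0 * Kmax) * (1 + C / \<kappa> * 0) - \<theta>\<^sup>2"
    unfolding Q_def[abs_def] by (intro tendsto_intros v_hs hs_eps \<sigma>0)
  then have "eventually (\<lambda>n. Q n < - c') sequentially"
    using c' by (intro order_tendstoD(2)) auto
  moreover have "eventually (\<lambda>n. \<sigma> n \<le> 1) sequentially"
    using \<sigma>0 by (rule small) simp
  moreover have "eventually (\<lambda>n. 1 / \<theta>\<^sup>2 \<le> rate n) sequentially"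
    using rate_at_top by (simp only: filterlim_at_top)
  moreover have "eventually (\<lambda>n. (\<theta> * k * G + L + G) / real n ^ Suc 2 \<le> (\<theta>' - \<theta>) * k / real n ^ 2) sequentially"
    using k \<theta> by (intro power_le_power) simp
  moreover have "eventually (\<lambda>n. W * real n ^ (2 + B * CARD('d)) \<le> exp ((c' - c) * rate n)) sequentially"
    using c' by (intro poly_le_exp_rate) simp
  ultimately show ?thesis
    using crude_bounds
  proof eventually_elim
    case (elim n)
    have n: "n \<ge> 1" "real n \<ge> 1" and b: "0 < hs n" "hs n \<le> 1" and e: "0 < \<epsilon> n" "\<epsilon> n \<le> 1"
      and ne: "1 / real n \<le> \<epsilon> n" and v: "1 \<le> v n" "v n \<le> real n" using elim by auto
    have sqe: "1 / real n \<le> sqrt (\<epsilon> n)" "sqrt (\<epsilon> n) > 0"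
    proof -
      have "\<epsilon> n = sqrt (\<epsilon> n) * sqrt (\<epsilon> n)" using e by simp
      also have "\<dots> \<le> sqrt (\<epsilon> n) * 1" using e by (intro mult_left_mono) auto
      finally show "1 / real n \<le> sqrt (\<epsilon> n)" using ne by simp
    qed (use e in simp)
    define N where "N = real n * hs n ^ CARD('d)"
    have N: "N > 0" using n b by (simp add: N_def)
    have rate: "rate n = N / (v n)\<^sup>2" by (simp add: rate_def N_def)
    define F where "F x = max (f x) (\<epsilon> n)" for x
    have F: "f x \<le> F x" "\<epsilon> n \<le> F x" "0 < F x" "sqrt (\<epsilon> n) \<le> sqrt (F x)" "0 < sqrt (F x)" for x
      using e by (auto simp: F_def)
    have sF: "sqrt (\<kappa> * F x) = k * sqrt (F x)" for x by (simp add: k_def real_sqrt_mult)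
    let ?\<tau> = "\<lambda>x. \<theta> * (k * sqrt (F x)) / v n"
    let ?s = "\<lambda>x. \<theta> / (v n * (k * sqrt (F x)))"
    \<comment> \<open>At this parameter both s \<tau> and s^2 \<kappa> max (f y) eps equal
      \<theta>^2 / v^2, so the point y drops out of the leading terms of the exponent.\<close>
    have s\<tau>: "?s y * ?\<tau> y = \<theta>\<^sup>2 / (v n)\<^sup>2" for y
      using k(1) F(5)[of y] v by (simp add: power2_eq_square)
    have s\<sigma>: "?s y \<le> \<sigma> n" for y
      unfolding \<sigma>_def using \<theta> v k F[of y] sqe by (intro divide_left_mono mult_left_mono mult_pos_pos) auto
    have s0: "0 \<le> ?s y" for y using \<theta> v k F(5)[of y] by simp
    have "prob {\<omega> \<in> space M. \<exists>x. \<theta>' * (k * sqrt (F x)) / v n < \<bar>kde K X n (hs n) \<omega> x - f x\<bar>}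
      \<le> (2 * exp Kmax * real n + 1 / (\<theta> * (k * sqrt (\<epsilon> n)) / v n)) * exp (- (c' * rate n))
        / (unit_ball_vol (CARD('d)) * (1 / real n ^ B) ^ CARD('d))"
    proof (rule uniform_deviation[where s="?s" and \<tau>="?\<tau>", OF n(1) b _ N_def])
      show "?\<tau> \<in> borel_measurable borel" unfolding F_def by measurable
      show "0 < \<theta> * (k * sqrt (\<epsilon> n)) / v n" using \<theta> k sqe v by simp
      fix y
      show "\<theta> * (k * sqrt (\<epsilon> n)) / v n \<le> ?\<tau> y"
        using \<theta> k v F(4) by (intro divide_right_mono mult_left_mono) auto
      show "?s y \<le> 1" using s\<sigma>[of y] elim(2) by linarith
      have "?s y * N * ?\<tau> y = \<theta>\<^sup>2 * rate n"
      proof -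
        have "?s y * N * ?\<tau> y = N * (?s y * ?\<tau> y)" by (simp only: mult_ac)
        then show ?thesis unfolding s\<tau> by (simp add: rate)
      qed
      then show "1 \<le> ?s y * N * ?\<tau> y"
        using elim(3) \<theta> by (simp add: field_simps)
      have t1: "?s y * (C * (hs n)\<^sup>2) \<le> \<theta> * C / k * (v n * (hs n)\<^sup>2 / sqrt (\<epsilon> n)) / (v n)\<^sup>2"
      proof -
        have "?s y * (C * (hs n)\<^sup>2) \<le> \<sigma> n * (C * (hs n)\<^sup>2)"
          using s\<sigma> C_nonneg by (intro mult_right_mono) auto
        also have "\<dots> = \<theta> * C / k * (v n * (hs n)\<^sup>2 / sqrt (\<epsilon> n)) / (v n)\<^sup>2"
          using v by (simp add: \<sigma>_def power2_eq_square)
        finally show ?thesis .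
      qed
      have t2: "(?s y)\<^sup>2 / 2 * exp (?s y * Kmax) * (\<kappa> * f y + C * hs n)
        \<le> \<theta>\<^sup>2 / 2 * exp (\<sigma> n * Kmax) * (1 + C / \<kappa> * (hs n / \<epsilon> n)) / (v n)\<^sup>2"
      proof -
        \<comment> \<open>The absolute error C hs is turned into a relative one: writing hs as (hs /
          eps) eps bounds it by a multiple of max (f y) eps.\<close>
        have "C * hs n = C * (hs n / \<epsilon> n) * \<epsilon> n" using e by simp
        also have "\<dots> \<le> C * (hs n / \<epsilon> n) * F y"
          using C_nonneg b e F by (intro mult_left_mono) auto
        finally have "C * hs n \<le> C * (hs n / \<epsilon> n) * F y" .
        moreover have "\<kappa> * f y \<le> \<kappa> * F y"
          using \<kappa>_pos F(1) by (intro mult_left_mono) auto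
        moreover have "\<kappa> * F y * (1 + C / \<kappa> * (hs n / \<epsilon> n)) = \<kappa> * F y + C * (hs n / \<epsilon> n) * F y"
          using \<kappa>_pos by (simp add: distrib_left)
        ultimately have "\<kappa> * f y + C * hs n \<le> \<kappa> * F y * (1 + C / \<kappa> * (hs n / \<epsilon> n))"
          by linarith
        moreover have "exp (?s y * Kmax) \<le> exp (\<sigma> n * Kmax)"
          using mult_right_mono[OF s\<sigma>[of y], of Kmax] Kmax_pos by simp
        ultimately have "(?s y)\<^sup>2 / 2 * exp (?s y * Kmax) * (\<kappa> * f y + C * hs n)
          \<le> (?s y)\<^sup>2 / 2 * exp (\<sigma> n * Kmax) * (\<kappa> * F y * (1 + C / \<kappa> * (hs n / \<epsilon> n)))"
          using \<kappa>_pos f_nonneg[of y] C_nonneg b by (intro mult_mono mult_left_mono) auto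
        also have "\<dots> = ((?s y)\<^sup>2 * (\<kappa> * F y)) * (exp (\<sigma> n * Kmax) / 2 * (1 + C / \<kappa> * (hs n / \<epsilon> n)))"
          by simp
        also have "(?s y)\<^sup>2 * (\<kappa> * F y) = \<theta>\<^sup>2 / (v n)\<^sup>2"
          using F(3)[of y] \<kappa>_pos k(2) by (simp add: power_divide power_mult_distrib)
        finally show ?thesis by simp
      qed
      have "?s y * (C * (hs n)\<^sup>2) + (?s y)\<^sup>2 / 2 * exp (?s y * Kmax) * (\<kappa> * f y + C * hs n) - ?s y * ?\<tau> y
          \<le> Q n / (v n)\<^sup>2"
        using t1 t2 unfolding s\<tau> Q_def add_divide_distrib diff_divide_distrib by linarith
      also have "\<dots> \<le> - c' / (v n)\<^sup>2" using elim(1) by (intro divide_right_mono) auto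
      finally have "N * (?s y * (C * (hs n)\<^sup>2) + (?s y)\<^sup>2 / 2 * exp (?s y * Kmax) * (\<kappa> * f y + C * hs n) - ?s y * ?\<tau> y)
          \<le> N * (- c' / (v n)\<^sup>2)"
        using N by (intro mult_left_mono) auto
      also have "\<dots> = - (c' * rate n)" by (simp add: rate)
      finally show "N * (?s y * (C * (hs n)\<^sup>2) + (?s y)\<^sup>2 / 2 * exp (?s y * Kmax) * (\<kappa> * f y + C * hs n) - ?s y * ?\<tau> y)
          \<le> - (c' * rate n)" .
      fix x assume xy: "norm (x - y) \<le> 1 / real n ^ B"
      \<comment> \<open>Truncation preserves the Lipschitz bound of f, and the square root above eps
        costs a factor 1 / sqrt eps <= n. Hence the threshold moves by at most order n^-3 within a
        ball.\<close>
      have "F y - F x \<le> \<bar>f y - f x\<bar>" by (auto simp: F_def max_def)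
      also have "\<dots> \<le> G * norm (y - x)" by (rule f_lipschitz)
      also have "\<dots> \<le> G * (1 / real n ^ B)" using xy G_nonneg by (intro mult_left_mono) (auto simp: norm_minus_commute)
      also have "\<dots> \<le> G / real n ^ 4" using B(2) n(1) by blast
      finally have "sqrt (F y) \<le> sqrt (F x) + G / real n ^ 4 / sqrt (\<epsilon> n)"
        using sqrt_diff_le[of "\<epsilon> n" "F x" "F y" "G / real n ^ 4"] e F G_nonneg by simp
      also have "\<dots> \<le> sqrt (F x) + G / real n ^ 4 * real n"
      proof -
        have "1 / sqrt (\<epsilon> n) \<le> real n" using sqe n by (simp add: field_simps)
        then show ?thesis
          using mult_left_mono[of "1 / sqrt (\<epsilon> n)" "real n" "G / real n ^ 4"] G_nonneg by simp
      qed
      also have "G / real n ^ 4 * real n = G / real n ^ 3"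
        using n by (simp add: field_simps numeral_eq_Suc)
      finally have "\<theta> * (k * sqrt (F y)) / v n \<le> \<theta> * (k * (sqrt (F x) + G / real n ^ 3)) / v n"
        using \<theta> k v by (intro divide_right_mono mult_left_mono) auto
      also have "\<dots> = \<theta> * (k * sqrt (F x)) / v n + \<theta> * k * G / real n ^ 3 / v n"
        by (simp add: distrib_left add_divide_distrib mult_ac)
      also have "\<theta> * k * G / real n ^ 3 / v n \<le> \<theta> * k * G / real n ^ 3 / 1"
        using \<theta> k v G_nonneg by (intro divide_left_mono) auto
      finally have d1: "\<theta> * (k * sqrt (F y)) / v n \<le> \<theta> * (k * sqrt (F x)) / v n + \<theta> * k * G / real n ^ 3"
        by simp
      have "L * (1 / real n ^ B / hs n) powr \<alpha> / hs n ^ CARD('d) + G * (1 / real n ^ B) \<le> L / real n ^ 4 + G / real n ^ 4"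
      proof (rule add_mono)
        show "L * (1 / real n ^ B / hs n) powr \<alpha> / hs n ^ CARD('d) \<le> L / real n ^ 4"
          using B(1) n(1) b elim(6) by blast
        show "G * (1 / real n ^ B) \<le> G / real n ^ 4" using B(2) n(1) by blast
      qed
      also have "\<dots> \<le> L / real n ^ 3 + G / real n ^ 3"
        using n L_nonneg G_nonneg by (intro add_mono divide_left_mono power_increasing) auto
      finally have d2: "L * (1 / real n ^ B / hs n) powr \<alpha> / hs n ^ CARD('d) + G * (1 / real n ^ B)
          \<le> L / real n ^ 3 + G / real n ^ 3" .
      \<comment> \<open>Since sqrt (F x) >= 1 / n and v <= n, the gap between the two thresholds is
        at least of order n^-2, more than the n^-3 of all perturbations.\<close>
      have "(\<theta>' - \<theta>) * k / real n ^ 2 = (\<theta>' - \<theta>) * (k * (1 / real n)) / real n"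
        by (simp add: power2_eq_square)
      also have "\<dots> \<le> (\<theta>' - \<theta>) * (k * sqrt (F x)) / v n"
        using \<theta> k v n sqe order_trans[OF sqe(1) F(4)[of x]] less_imp_le[OF F(3)[of x]]
        by (intro frac_le mult_left_mono mult_nonneg_nonneg) auto
      finally have d3: "(\<theta> * k * G + L + G) / real n ^ 3 \<le> (\<theta>' - \<theta>) * (k * sqrt (F x)) / v n"
        using elim(4) by (simp add: eval_nat_numeral)
      have "(\<theta>' - \<theta>) * (k * sqrt (F x)) / v n = \<theta>' * (k * sqrt (F x)) / v n - \<theta> * (k * sqrt (F x)) / v n"
        by (simp add: algebra_simps diff_divide_distrib)
      then show "\<theta> * (k * sqrt (F y)) / v n + L * (1 / real n ^ B / hs n) powr \<alpha> / hs n ^ CARD('d) + G * (1 / real n ^ B)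
          \<le> \<theta>' * (k * sqrt (F x)) / v n"
        using d1 d2 d3 unfolding add_divide_distrib by linarith
    qed (use s0 n in auto)
    also have "\<dots> \<le> (2 * exp Kmax * real n ^ 2 + 1 / (\<theta> * k) * real n ^ 2) * exp (- (c' * rate n))
        / (unit_ball_vol (CARD('d)) * (1 / real n ^ B) ^ CARD('d))"
    proof (intro divide_right_mono mult_right_mono add_mono)
      show "2 * exp Kmax * real n \<le> 2 * exp Kmax * real n ^ 2"
        using n by (simp add: power2_eq_square)
      have "1 / sqrt (\<epsilon> n) \<le> real n" using sqe n by (simp add: field_simps)
      then have "v n * (1 / sqrt (\<epsilon> n)) \<le> real n * real n" using v sqe n by (intro mult_mono) auto
      then have "1 / (\<theta> * k) * (v n * (1 / sqrt (\<epsilon> n))) \<le> 1 / (\<theta> * k) * (real n * real n)"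
        using \<theta> k by (intro mult_left_mono) auto
      then show "1 / (\<theta> * (k * sqrt (\<epsilon> n)) / v n) \<le> 1 / (\<theta> * k) * real n ^ 2"
        by (simp add: power2_eq_square)
    qed auto
    also have "\<dots> = W * real n ^ (2 + B * CARD('d)) * exp (- (c' * rate n))"
      using n V \<theta> k(1) by (simp add: W_def V_def[symmetric] power_add power_mult power_divide power2_eq_square field_simps)
    also have "\<dots> \<le> exp ((c' - c) * rate n) * exp (- (c' * rate n))"
      using elim by (intro mult_right_mono) auto
    also have "\<dots> = exp (- c * rate n)"
      by (simp flip: exp_add) (simp add: algebra_simps)
    finally show ?case unfolding F_def[symmetric] sF .
  qed
qed

section \<open>Pointwise lower bound from the Gaussian limit\<close>

lemma v_hs_sq: "(\<lambda>n. v n * (hs n)\<^sup>2) \<longlonglongrightarrow> 0"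
proof -
  have "(\<lambda>n. sqrt (\<epsilon> n)) \<longlonglongrightarrow> sqrt 0" by (intro tendsto_intros eps_lim)
  then have "(\<lambda>n. v n * (hs n)\<^sup>2 / sqrt (\<epsilon> n) * sqrt (\<epsilon> n)) \<longlonglongrightarrow> 0 * sqrt 0"
    by (intro tendsto_mult v_hs)
  then have "(\<lambda>n. v n * (hs n)\<^sup>2 / sqrt (\<epsilon> n) * sqrt (\<epsilon> n)) \<longlonglongrightarrow> 0" by simp
  moreover have "eventually (\<lambda>n. v n * (hs n)\<^sup>2 / sqrt (\<epsilon> n) * sqrt (\<epsilon> n) = v n * (hs n)\<^sup>2) sequentially"
    using crude_bounds by eventually_elim auto
  ultimately show ?thesis by (rule Lim_transform_eventually)
qed

text \<open>For 0 <= \<psi> <= 1, which \<open>small\<close> ensures, ln (1 + \<psi>) lies between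
  \<psi> - \<psi>^2 and \<psi>. As \<psi> is of order at most s b^d, its square carries an extra
  factor b^d compared with the main term of order s^2 b^d. The subtracted b^d s f x accounts for
  centring the estimator at f x.\<close>

lemma log_mgf_bounds:
  assumes fx: "f x > 0" and n: "n \<ge> 1" and b: "0 < b" "b \<le> 1" and s: "0 \<le> s" "s \<le> 1"
    and small: "s * exp Kmax * (f x + C) \<le> 1"
  shows "b ^ CARD('d) * (- (s * C * b\<^sup>2) + s\<^sup>2 / 2 * (\<kappa> * f x - C * b)
        - (s * exp Kmax * (f x + C))\<^sup>2 * b ^ CARD('d)) \<le> ln (mgf s b x) - b ^ CARD('d) * (s * f x)"
    and "ln (mgf s b x) - b ^ CARD('d) * (s * f x)
        \<le> b ^ CARD('d) * (s * C * b\<^sup>2 + s\<^sup>2 / 2 * exp (s * Kmax) * (\<kappa> * f x + C * b))"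
proof -
  define \<psi> where "\<psi> = mgf s b x - 1"
  let ?bd = "b ^ CARD('d)"
  have bd: "0 < ?bd" "?bd \<le> 1" using b by (auto simp: power_le_one)
  have factor: "s * (?bd * u) + z * (?bd * w) = ?bd * (s * u + z * w)" for u z w :: real
    by (simp add: algebra_simps)
  have p: "?bd * (f x - C * b\<^sup>2) \<le> p b x" "p b x \<le> ?bd * (f x + C * b\<^sup>2)"
    using p_approx[OF b(1), of x] by (auto simp: algebra_simps abs_le_iff)
  have q: "?bd * (\<kappa> * f x - C * b) \<le> q b x" "q b x \<le> ?bd * (\<kappa> * f x + C * b)"
    using q_approx[OF b(1), of x] by (auto simp: algebra_simps abs_le_iff)
  have low: "?bd * (s * (f x - C * b\<^sup>2) + s\<^sup>2 / 2 * (\<kappa> * f x - C * b)) \<le> \<psi>"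
  proof -
    have "s * (?bd * (f x - C * b\<^sup>2)) + s\<^sup>2 / 2 * (?bd * (\<kappa> * f x - C * b)) \<le> s * p b x + s\<^sup>2 / 2 * q b x"
      using p q s by (intro add_mono mult_left_mono) auto
    also have "\<dots> \<le> \<psi>" using mgf_ge[OF s(1), of b x] by (simp add: \<psi>_def)
    also have "s * (?bd * (f x - C * b\<^sup>2)) + s\<^sup>2 / 2 * (?bd * (\<kappa> * f x - C * b))
        = ?bd * (s * (f x - C * b\<^sup>2) + s\<^sup>2 / 2 * (\<kappa> * f x - C * b))"
      by (rule factor)
    finally show ?thesis .
  qed
  have up: "\<psi> \<le> ?bd * (s * (f x + C * b\<^sup>2) + s\<^sup>2 / 2 * exp (s * Kmax) * (\<kappa> * f x + C * b))"
  proof -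
    have "\<psi> \<le> s * p b x + s\<^sup>2 / 2 * exp (s * Kmax) * q b x"
      using mgf_le[OF s(1), of b x] by (simp add: \<psi>_def)
    also have "\<dots> \<le> s * (?bd * (f x + C * b\<^sup>2)) + s\<^sup>2 / 2 * exp (s * Kmax) * (?bd * (\<kappa> * f x + C * b))"
      using p q s by (intro add_mono mult_left_mono) auto
    also have "\<dots> = ?bd * (s * (f x + C * b\<^sup>2) + s\<^sup>2 / 2 * exp (s * Kmax) * (\<kappa> * f x + C * b))"
      by (rule factor)
    finally show ?thesis .
  qed
  have \<psi>0: "0 \<le> \<psi>"
  proof -
    have "0 \<le> s * p b x + s\<^sup>2 / 2 * q b x"
      using s p_nonneg q_nonneg by (intro add_nonneg_nonneg mult_nonneg_nonneg) auto
    then show ?thesis using mgf_ge[OF s(1), of b x] by (simp add: \<psi>_def)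
  qed
  have \<psi>u: "\<psi> \<le> s * exp Kmax * (f x + C) * ?bd"
  proof -
    have "\<psi> \<le> s * exp (s * Kmax) * p b x"
      using mgf_minus_one_le[OF s(1), of b x] by (simp add: \<psi>_def)
    also have "\<dots> \<le> s * exp Kmax * (?bd * (f x + C))"
    proof (rule mult_mono)
      show "s * exp (s * Kmax) \<le> s * exp Kmax"
        using s Kmax_pos mult_right_mono[OF s(2), of Kmax] by (intro mult_left_mono) auto
      have "C * b\<^sup>2 \<le> C * 1" using b C_nonneg by (intro mult_left_mono) (auto simp: power_le_one)
      then have "?bd * (f x + C * b\<^sup>2) \<le> ?bd * (f x + C)" using bd by (intro mult_left_mono) auto
      then show "p b x \<le> ?bd * (f x + C)" using p by linarith
    qed (use s p_nonneg in auto)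
    finally show ?thesis by (simp add: mult_ac)
  qed
  have A0: "0 \<le> s * exp Kmax * (f x + C)" using s fx C_nonneg by simp
  have \<psi>1: "\<psi> \<le> 1"
    using \<psi>u mult_mono[OF small bd(2)] bd A0 by simp
  have "\<psi>\<^sup>2 \<le> (s * exp Kmax * (f x + C) * ?bd)\<^sup>2"
    using \<psi>u \<psi>0 by (rule power_mono)
  also have "\<dots> = ?bd * ((s * exp Kmax * (f x + C))\<^sup>2 * ?bd)"
    by (simp add: power_mult_distrib power2_eq_square)
  finally have sq: "\<psi>\<^sup>2 \<le> ?bd * ((s * exp Kmax * (f x + C))\<^sup>2 * ?bd)" .
  have mgf: "mgf s b x = 1 + \<psi>" by (simp add: \<psi>_def)
  have "\<psi> - \<psi>\<^sup>2 \<le> ln (1 + \<psi>)" using \<psi>0 \<psi>1 by (rule ln_one_plus_pos_lower_bound)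
  then show "b ^ CARD('d) * (- (s * C * b\<^sup>2) + s\<^sup>2 / 2 * (\<kappa> * f x - C * b)
        - (s * exp Kmax * (f x + C))\<^sup>2 * b ^ CARD('d)) \<le> ln (mgf s b x) - b ^ CARD('d) * (s * f x)"
    using low sq unfolding mgf distrib_left[of ?bd] right_diff_distrib[of ?bd] right_diff_distrib[of s]
      mult_minus_right mult.assoc by linarith
  have "ln (1 + \<psi>) \<le> \<psi>" using \<psi>0 by (rule ln_add_one_self_le_self)
  then show "ln (mgf s b x) - b ^ CARD('d) * (s * f x)
        \<le> b ^ CARD('d) * (s * C * b\<^sup>2 + s\<^sup>2 / 2 * exp (s * Kmax) * (\<kappa> * f x + C * b))"
    using up unfolding mgf distrib_left[of ?bd] distrib_left[of s] mult.assoc by linarith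
qed

lemma mgf_positive: "mgf s b x > 0"
proof -
  have "expectation (\<lambda>\<omega>. exp (s * S 1 b x \<omega>)) \<ge> 0" by (rule integral_nonneg_AE) simp
  moreover have "expectation (\<lambda>\<omega>. exp (s * S 1 b x \<omega>)) \<noteq> 0"
    using integral_nonneg_eq_0_iff_AE[OF integrable_exp_S[of s 1 b x]] AE_False by simp
  ultimately show ?thesis by (simp add: expectation_exp_S)
qed

lemma pointwise_lower:
  assumes fx: "f x > 0" and \<theta>: "\<theta> > 0" and c: "c > \<theta>\<^sup>2 / 2"
  shows "eventually (\<lambda>n. exp (- c * rate n)
    \<le> prob {\<omega> \<in> space M. \<theta> * sqrt (\<kappa> * f x) / v n \<le> kde K X n (hs n) \<omega> x - f x}) sequentially"
proof -
  define k where "k = sqrt (\<kappa> * f x)"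
  have k: "k > 0" "k\<^sup>2 = \<kappa> * f x" using \<kappa>_pos fx by (auto simp: k_def)
  define Z where "Z n \<omega> = v n * (kde K X n (hs n) \<omega> x - f x) / k" for n \<omega>
  have Zexp: "exp (t * Z n \<omega>) = exp (- (t * v n * f x / k)) * exp (t * v n / (k * (real n * hs n ^ CARD('d))) * S n (hs n) x \<omega>)" for t n \<omega>
    by (simp add: Z_def kde_eq_S right_diff_distrib left_diff_distrib diff_divide_distrib mult_ac flip: exp_add)
  have "eventually (\<lambda>n. exp (- c * rate n) \<le> prob {\<omega> \<in> space M. \<theta> \<le> Z n \<omega>}) sequentially"
  proof (rule gaussian_mgf_lower_bound[OF rate_at_top _ _ _ \<theta> c])
    show "Z n \<in> borel_measurable M" for n unfolding Z_def by measurable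
    show "integrable M (\<lambda>\<omega>. exp (t * Z n \<omega>))" for t n
      unfolding Zexp by (intro integrable_mult_right integrable_exp_S)
    fix t :: real assume t: "t > 0"
    \<comment> \<open>The parameter on the kernel sum that corresponds to rate * t on Z. Since v s =
      t / k is constant and k^2 = \<kappa> f x, the quadratic term v^2 s^2 \<kappa> f x / 2 is
      exactly t^2 / 2.\<close>
    define s where "s n = t / (v n * k)" for n
    define A where "A = exp Kmax * (f x + C)"
    have A: "A \<ge> 0" unfolding A_def using fx C_nonneg by simp
    have s0: "s \<longlonglongrightarrow> 0"
    proof -
      have "(\<lambda>n. t / k * inverse (v n)) \<longlonglongrightarrow> 0"
        by (intro tendsto_mult_right_zero tendsto_inverse_0_at_top v_lim)
      then show ?thesis by (simp add: s_def[abs_def] divide_inverse mult_ac)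
    qed
    have hsd: "(\<lambda>n. hs n ^ CARD('d)) \<longlonglongrightarrow> 0"
      using tendsto_power[OF hs_lim, of "CARD('d)"] by (simp add: zero_power)
    \<comment> \<open>\<open>lo\<close> and \<open>up\<close> are the two bounds of
      \<open>log_mgf_bounds\<close> multiplied by v^2, which is n hs^d / rate.\<close>
    define lo where "lo n = - (t * C / k * (v n * (hs n)\<^sup>2)) + t\<^sup>2 / (2 * k\<^sup>2) * (\<kappa> * f x - C * hs n)
        - (t * A / k)\<^sup>2 * hs n ^ CARD('d)" for n
    define up where "up n = t * C / k * (v n * (hs n)\<^sup>2) + t\<^sup>2 / (2 * k\<^sup>2) * exp (s n * Kmax) * (\<kappa> * f x + C * hs n)" for n
    have "lo \<longlonglongrightarrow> - (t * C / k * 0) + t\<^sup>2 / (2 * k\<^sup>2) * (\<kappa> * f x - C * 0) - (t * A / k)\<^sup>2 * 0"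
      unfolding lo_def[abs_def] by (intro tendsto_intros v_hs_sq hs_lim hsd)
    then have lo: "lo \<longlonglongrightarrow> t\<^sup>2 / 2" using k \<kappa>_pos fx by simp
    have "up \<longlonglongrightarrow> t * C / k * 0 + t\<^sup>2 / (2 * k\<^sup>2) * exp (0 * Kmax) * (\<kappa> * f x + C * 0)"
      unfolding up_def[abs_def] by (intro tendsto_intros v_hs_sq hs_lim hsd s0)
    then have up: "up \<longlonglongrightarrow> t\<^sup>2 / 2" using k \<kappa>_pos fx by simp
    have "eventually (\<lambda>n. s n * A \<le> 1) sequentially"
      using tendsto_mult_left_zero[OF s0, of A] by (rule small) simp
    moreover have "eventually (\<lambda>n. s n \<le> 1) sequentially" using s0 by (rule small) simp
    ultimately have "eventually (\<lambda>n. lo n \<le> ln (expectation (\<lambda>\<omega>. exp (rate n * t * Z n \<omega>))) / rate n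
        \<and> ln (expectation (\<lambda>\<omega>. exp (rate n * t * Z n \<omega>))) / rate n \<le> up n) sequentially"
      using crude_bounds
    proof eventually_elim
      case (elim n)
      have n: "n \<ge> 1" and b: "0 < hs n" "hs n \<le> 1" and v: "v n \<ge> 1" using elim by auto
      define bd where "bd = hs n ^ CARD('d)"
      define m where "m = ln (mgf (s n) (hs n) x) - bd * (s n * f x)"
      have bd: "bd > 0" using b by (simp add: bd_def)
      have sn: "0 \<le> s n" using t v k by (simp add: s_def)
      have vs: "v n * s n = t / k" using v by (simp add: s_def)
      have r: "rate n = real n * bd / (v n)\<^sup>2" by (simp add: rate_def bd_def)
      have e1: "rate n * t * v n / (k * (real n * bd)) = s n"
        using n bd v k by (simp add: r s_def power2_eq_square)
      have e2: "rate n * t * v n * f x / k = real n * bd * (s n * f x)"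
        using n bd v k by (simp add: r s_def power2_eq_square)
      have "expectation (\<lambda>\<omega>. exp (rate n * t * Z n \<omega>)) = exp (- (real n * bd * (s n * f x))) * mgf (s n) (hs n) x ^ n"
        unfolding Zexp using e1 e2 by (simp add: expectation_exp_S bd_def)
      then have ln: "ln (expectation (\<lambda>\<omega>. exp (rate n * t * Z n \<omega>))) = real n * m"
        using mgf_positive[of "s n" "hs n" x] less_imp_neq[OF mgf_positive[of "s n" "hs n" x]]
        by (simp add: ln_mult ln_realpow m_def right_diff_distrib)
      have scale: "real n * (bd * y) / rate n = (v n)\<^sup>2 * y" for y
        using n bd v by (simp add: r)
      have bounds: "bd * (- (s n * C * (hs n)\<^sup>2) + (s n)\<^sup>2 / 2 * (\<kappa> * f x - C * hs n) - (s n * A)\<^sup>2 * bd) \<le> m"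
        "m \<le> bd * (s n * C * (hs n)\<^sup>2 + (s n)\<^sup>2 / 2 * exp (s n * Kmax) * (\<kappa> * f x + C * hs n))"
        using log_mgf_bounds[OF fx n b sn] elim unfolding m_def bd_def A_def by (auto simp: mult.assoc)
      have rn: "rate n > 0" using n bd v by (simp add: r)
      have sq: "(v n)\<^sup>2 * (s n)\<^sup>2 = t\<^sup>2 / k\<^sup>2"
        by (simp add: vs power_divide flip: power_mult_distrib)
      have "lo n = (v n)\<^sup>2 * (- (s n * C * (hs n)\<^sup>2) + (s n)\<^sup>2 / 2 * (\<kappa> * f x - C * hs n) - (s n * A)\<^sup>2 * bd)"
      proof -
        have "(v n)\<^sup>2 * (- (s n * C * (hs n)\<^sup>2) + (s n)\<^sup>2 / 2 * (\<kappa> * f x - C * hs n) - (s n * A)\<^sup>2 * bd)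
          = - ((v n * s n) * C * (v n * (hs n)\<^sup>2)) + ((v n)\<^sup>2 * (s n)\<^sup>2) / 2 * (\<kappa> * f x - C * hs n)
            - ((v n)\<^sup>2 * (s n)\<^sup>2) * A\<^sup>2 * bd"
          by (simp add: power2_eq_square algebra_simps)
        then show ?thesis unfolding vs sq lo_def bd_def by (simp add: power_divide power_mult_distrib)
      qed
      also have "\<dots> \<le> real n * m / rate n"
        unfolding scale[symmetric] using bounds(1) rn by (intro divide_right_mono mult_left_mono) auto
      finally have 1: "lo n \<le> real n * m / rate n" .
      have "real n * m / rate n \<le> (v n)\<^sup>2 * (s n * C * (hs n)\<^sup>2 + (s n)\<^sup>2 / 2 * exp (s n * Kmax) * (\<kappa> * f x + C * hs n))"
        unfolding scale[symmetric] using bounds(2) rn by (intro divide_right_mono mult_left_mono) auto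
      also have "\<dots> = up n"
      proof -
        have "(v n)\<^sup>2 * (s n * C * (hs n)\<^sup>2 + (s n)\<^sup>2 / 2 * exp (s n * Kmax) * (\<kappa> * f x + C * hs n))
          = (v n * s n) * C * (v n * (hs n)\<^sup>2) + ((v n)\<^sup>2 * (s n)\<^sup>2) / 2 * exp (s n * Kmax) * (\<kappa> * f x + C * hs n)"
          by (simp add: power2_eq_square algebra_simps)
        then show ?thesis unfolding vs sq up_def by simp
      qed
      finally show ?case using 1 by (simp add: ln)
    qed
    then show "(\<lambda>n. ln (expectation (\<lambda>\<omega>. exp (rate n * t * Z n \<omega>))) / rate n) \<longlonglongrightarrow> t\<^sup>2 / 2"
      using lo up by (rule tendsto_sandwich_eventually)
  qed
  then show ?thesis
    using crude_bounds
  proof eventually_elim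
    case (elim n)
    have "{\<omega> \<in> space M. \<theta> \<le> Z n \<omega>} = {\<omega> \<in> space M. \<theta> * sqrt (\<kappa> * f x) / v n \<le> kde K X n (hs n) \<omega> x - f x}"
      using elim k by (auto simp: Z_def k_def[symmetric] field_simps)
    then show ?case using elim by simp
  qed
qed

section \<open>The exceedance event\<close>

lemma kde_continuous: "continuous_on UNIV (kde K X n b \<omega>)"
  unfolding kde_def[abs_def]
  by (intro continuous_intros continuous_on_compose2[OF K_continuous]) auto

lemma trunc_kde_eq: "trunc_kde K X n b e \<omega> x = max (kde K X n b \<omega> x) e"
  by (simp add: trunc_kde_def)

text \<open>Leaving the closed band is written as a strict inequality between continuous functions
  of x, the form to which \<open>sets_Ex_pos\<close> applies.\<close>

definition exceed :: "real \<Rightarrow> nat \<Rightarrow> 'w set"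
  where "exceed \<delta> n = {\<omega> \<in> space M. \<exists>x.
    \<delta> * sqrt (trunc_kde K X n (h n) (\<epsilon> n) \<omega> x * \<kappa>) / v n < \<bar>f x - kde K X n (hs n) \<omega> x\<bar>}"

lemma exceed_sets: "exceed \<delta> n \<in> sets M"
proof -
  have "{\<omega> \<in> space M. \<exists>x. 0 < \<bar>f x - kde K X n (hs n) \<omega> x\<bar> -
      \<delta> * sqrt (max (kde K X n (h n) \<omega> x) (\<epsilon> n) * \<kappa>) / v n} \<in> sets M"
  proof (rule sets_Ex_pos)
    show "continuous_on UNIV (\<lambda>x. \<bar>f x - kde K X n (hs n) \<omega> x\<bar> -
      \<delta> * sqrt (max (kde K X n (h n) \<omega> x) (\<epsilon> n) * \<kappa>) / v n)" for \<omega>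
      unfolding divide_inverse by (intro continuous_intros f_continuous kde_continuous)
  qed measurable
  then show ?thesis by (simp add: exceed_def trunc_kde_eq)
qed

lemma uniform_event_sets:
  assumes "continuous_on UNIV \<tau>"
  shows "{\<omega> \<in> space M. \<exists>x. \<tau> x < \<bar>kde K X n b \<omega> x - f x\<bar>} \<in> sets M"
proof -
  have "{\<omega> \<in> space M. \<exists>x. 0 < \<bar>kde K X n b \<omega> x - f x\<bar> - \<tau> x} \<in> sets M"
  proof (rule sets_Ex_pos)
    show "continuous_on UNIV (\<lambda>x. \<bar>kde K X n b \<omega> x - f x\<bar> - \<tau> x)" for \<omega>
      by (intro continuous_intros f_continuous kde_continuous assms)
  qed measurable
  then show ?thesis by simp
qed

lemma exceed_upper:
  assumes \<delta>: "\<delta> > 0" and c: "c < \<delta>\<^sup>2 / 2"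
  shows "eventually (\<lambda>n. prob (exceed \<delta> n) \<le> exp (- c * rate n)) sequentially"
proof -
  have "((\<lambda>\<eta>. (\<delta> * (1 - \<eta>))\<^sup>2 / 2) \<longlongrightarrow> (\<delta> * (1 - 0))\<^sup>2 / 2) (at_right 0)"
    by (intro tendsto_intros) auto
  then have "eventually (\<lambda>\<eta>. c < (\<delta> * (1 - \<eta>))\<^sup>2 / 2) (at_right 0)"
    using c by (intro order_tendstoD) auto
  moreover have "eventually (\<lambda>\<eta>::real. 0 < \<eta> \<and> \<eta> < 1) (at_right 0)"
    using eventually_at_right_less[of 0] eventually_at_right_real[of 0 "1::real"]
    by (auto elim: eventually_mono)
  ultimately have "\<exists>\<eta>. c < (\<delta> * (1 - \<eta>))\<^sup>2 / 2 \<and> 0 < \<eta> \<and> \<eta> < 1"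
    using eventually_happens'[OF trivial_limit_at_right_real] eventually_conj by blast
  then obtain \<eta> where \<eta>: "c < (\<delta> * (1 - \<eta>))\<^sup>2 / 2" "0 < \<eta>" "\<eta> < 1" by blast
  \<comment> \<open>Replacing f_n by f inside the truncation costs 1 - \<eta>, hence sqrt (1 -
    \<eta>) in the threshold: this is \<theta>'. The smaller value \<theta> supplies the strict gap
    that \<open>main_uniform\<close> requires and still tends to \<delta>.\<close>
  define \<theta> where "\<theta> = \<delta> * (1 - \<eta>)"
  define \<theta>' where "\<theta>' = \<delta> * sqrt (1 - \<eta>)"
  have "(1 - \<eta>) * (1 - \<eta>) < (1 - \<eta>) * 1" using \<eta> by (intro mult_strict_left_mono) auto
  then have "1 - \<eta> < sqrt (1 - \<eta>)" by (intro real_less_rsqrt) (simp add: power2_eq_square)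
  then have \<theta>: "0 < \<theta>" "\<theta> < \<theta>'" using \<delta> \<eta> by (auto simp: \<theta>_def \<theta>'_def)
  obtain c' where c': "c < c'" "c' < \<theta>\<^sup>2 / 2" using dense[OF \<eta>(1)] unfolding \<theta>_def by blast
  have "c' - c > 0" using c' by simp
  from poly_le_exp_rate[OF this, of 2 0] pilot_uniform[OF \<eta>(2), of c'] main_uniform[OF \<theta> c'(2)] crude_bounds
  show ?thesis
  proof eventually_elim
    case (elim n)
    define A where "A = {\<omega> \<in> space M. \<exists>x. \<eta> * \<epsilon> n < \<bar>kde K X n (h n) \<omega> x - f x\<bar>}"
    define B where "B = {\<omega> \<in> space M. \<exists>x. \<theta>' * sqrt (\<kappa> * max (f x) (\<epsilon> n)) / v n < \<bar>kde K X n (hs n) \<omega> x - f x\<bar>}"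
    have A: "A \<in> sets M" unfolding A_def by (intro uniform_event_sets continuous_intros)
    have B: "B \<in> sets M" unfolding B_def divide_inverse
      by (intro uniform_event_sets continuous_intros f_continuous)
    have "exceed \<delta> n \<subseteq> A \<union> B"
    proof
      fix \<omega> assume "\<omega> \<in> exceed \<delta> n"
      then obtain x where \<omega>: "\<omega> \<in> space M" and
        x: "\<delta> * sqrt (max (kde K X n (h n) \<omega> x) (\<epsilon> n) * \<kappa>) / v n < \<bar>kde K X n (hs n) \<omega> x - f x\<bar>"
        by (auto simp: exceed_def trunc_kde_eq abs_minus_commute)
      show "\<omega> \<in> A \<union> B"
      proof (rule ccontr)
        assume n: "\<omega> \<notin> A \<union> B"
        then have a: "\<bar>kde K X n (h n) \<omega> x - f x\<bar> \<le> \<eta> * \<epsilon> n"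
          using \<omega> by (auto simp: A_def not_less)
        have "(1 - \<eta>) * max (f x) (\<epsilon> n) \<le> max (kde K X n (h n) \<omega> x) (\<epsilon> n)"
        proof (cases "f x \<le> \<epsilon> n")
          case True
          then show ?thesis using \<eta> elim by (simp add: le_max_iff_disj left_diff_distrib)
        next
          case False
          have "\<eta> * \<epsilon> n \<le> \<eta> * f x" using False \<eta> by (intro mult_left_mono) auto
          then have "(1 - \<eta>) * f x \<le> kde K X n (h n) \<omega> x"
            using a unfolding left_diff_distrib by linarith
          then show ?thesis using False by (simp add: le_max_iff_disj)
        qed
        then have "sqrt ((1 - \<eta>) * max (f x) (\<epsilon> n) * \<kappa>) \<le> sqrt (max (kde K X n (h n) \<omega> x) (\<epsilon> n) * \<kappa>)"
          using \<kappa>_pos by (intro real_sqrt_le_mono mult_right_mono) auto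
        then have "\<theta>' * sqrt (\<kappa> * max (f x) (\<epsilon> n)) \<le> \<delta> * sqrt (max (kde K X n (h n) \<omega> x) (\<epsilon> n) * \<kappa>)"
          using \<delta> by (simp add: \<theta>'_def real_sqrt_mult mult_ac)
        then have "\<theta>' * sqrt (\<kappa> * max (f x) (\<epsilon> n)) / v n < \<bar>kde K X n (hs n) \<omega> x - f x\<bar>"
          using x elim by (meson divide_right_mono le_less_trans order_trans zero_le_one)
        then show False using n \<omega> by (auto simp: B_def)
      qed
    qed
    then have "prob (exceed \<delta> n) \<le> prob (A \<union> B)"
      using A B by (intro finite_measure_mono) auto
    also have "\<dots> \<le> prob A + prob B" using A B by (rule measure_Un_le)
    also have "\<dots> \<le> 2 * exp (- c' * rate n)" using elim unfolding A_def B_def by linarith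
    also have "\<dots> \<le> exp ((c' - c) * rate n) * exp (- c' * rate n)"
      using elim by (intro mult_right_mono) auto
    also have "\<dots> = exp (- c * rate n)" by (simp add: algebra_simps flip: exp_add)
    finally show ?case .
  qed
qed

text \<open>At a fixed x with f x > 0 the truncation is eventually inactive in the limit: if |f_n -
  f| <= eps then max (f_n x, eps) <= (1 + \<eta> / 2) f x, so a deviation of f_n^* at level \<delta>
  (1 + \<eta>) forces exceedance. The pilot event is taken with exponent c' + 1, so that removing it
  leaves at least half of exp (- c' rate); the gap c - c' then pays for that half.\<close>

lemma exceed_lower:
  assumes \<delta>: "\<delta> > 0" and c: "\<delta>\<^sup>2 / 2 < c"
  shows "eventually (\<lambda>n. exp (- c * rate n) \<le> prob (exceed \<delta> n)) sequentially"
proof -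
  obtain x where fx: "f x > 0" using exists_f_pos by blast
  have "((\<lambda>\<eta>. (\<delta> * (1 + \<eta>))\<^sup>2 / 2) \<longlongrightarrow> (\<delta> * (1 + 0))\<^sup>2 / 2) (at_right 0)"
    by (intro tendsto_intros) auto
  then have "eventually (\<lambda>\<eta>. (\<delta> * (1 + \<eta>))\<^sup>2 / 2 < c) (at_right 0)"
    using c by (intro order_tendstoD) auto
  then have "\<exists>\<eta>. (\<delta> * (1 + \<eta>))\<^sup>2 / 2 < c \<and> 0 < \<eta>"
    using eventually_happens'[OF trivial_limit_at_right_real] eventually_conj[OF _ eventually_at_right_less] by blast
  then obtain \<eta> where \<eta>: "(\<delta> * (1 + \<eta>))\<^sup>2 / 2 < c" "0 < \<eta>" by blast
  define \<theta> where "\<theta> = \<delta> * (1 + \<eta>)"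
  have \<theta>: "0 < \<theta>" using \<delta> \<eta> by (simp add: \<theta>_def)
  obtain c' where c': "\<theta>\<^sup>2 / 2 < c'" "c' < c" using dense[OF \<eta>(1)] unfolding \<theta>_def by blast
  have cc: "c - c' > 0" using c' by simp
  have "\<eta> * f x / 2 > 0" using \<eta> fx by simp
  then have "eventually (\<lambda>n. \<epsilon> n \<le> \<eta> * f x / 2) sequentially" by (rule small[OF eps_lim])
  then show ?thesis
    using poly_le_exp_rate[OF cc, of 2 0] poly_le_exp_rate[OF zero_less_one, of 2 0]
      pilot_uniform[OF zero_less_one, of "c' + 1"] pointwise_lower[OF fx \<theta> c'(1)] crude_bounds
  proof eventually_elim
    case (elim n)
    define A where "A = {\<omega> \<in> space M. \<exists>x. 1 * \<epsilon> n < \<bar>kde K X n (h n) \<omega> x - f x\<bar>}"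
    define B where "B = {\<omega> \<in> space M. \<theta> * sqrt (\<kappa> * f x) / v n \<le> kde K X n (hs n) \<omega> x - f x}"
    have A: "A \<in> sets M" unfolding A_def by (intro uniform_event_sets continuous_intros)
    have "B \<subseteq> A \<union> exceed \<delta> n"
    proof
      fix \<omega> assume \<omega>: "\<omega> \<in> B"
      show "\<omega> \<in> A \<union> exceed \<delta> n"
      proof (rule ccontr)
        assume n: "\<omega> \<notin> A \<union> exceed \<delta> n"
        then have "\<bar>kde K X n (h n) \<omega> x - f x\<bar> \<le> \<epsilon> n"
          using \<omega> by (auto simp: A_def B_def not_less)
        then have "max (kde K X n (h n) \<omega> x) (\<epsilon> n) \<le> f x + \<eta> * f x / 2"
          using elim fx by auto
        also have "\<dots> < (1 + \<eta>) * f x" using \<eta> fx by (simp add: field_simps)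
        also have "\<dots> \<le> (1 + \<eta>)\<^sup>2 * f x"
          using \<eta> fx by (intro mult_right_mono) (auto simp: power2_eq_square algebra_simps)
        finally have "max (kde K X n (h n) \<omega> x) (\<epsilon> n) * \<kappa> < (1 + \<eta>)\<^sup>2 * f x * \<kappa>"
          using \<kappa>_pos by simp
        then have "sqrt (max (kde K X n (h n) \<omega> x) (\<epsilon> n) * \<kappa>) < sqrt ((1 + \<eta>)\<^sup>2 * f x * \<kappa>)"
          by (rule real_sqrt_less_mono)
        also have "\<dots> = (1 + \<eta>) * sqrt (\<kappa> * f x)"
          using \<eta> by (simp add: real_sqrt_mult mult_ac)
        finally have "\<delta> * sqrt (max (kde K X n (h n) \<omega> x) (\<epsilon> n) * \<kappa>) < \<theta> * sqrt (\<kappa> * f x)"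
          using \<delta> by (simp add: \<theta>_def)
        then have "\<delta> * sqrt (max (kde K X n (h n) \<omega> x) (\<epsilon> n) * \<kappa>) / v n < \<theta> * sqrt (\<kappa> * f x) / v n"
          using elim by (intro divide_strict_right_mono) auto
        also have "\<dots> \<le> \<bar>f x - kde K X n (hs n) \<omega> x\<bar>"
          using \<omega> by (auto simp: B_def)
        finally show False using n \<omega> by (auto simp: exceed_def trunc_kde_eq B_def)
      qed
    qed
    then have "prob B \<le> prob (A \<union> exceed \<delta> n)"
      using A exceed_sets by (intro finite_measure_mono) auto
    also have "\<dots> \<le> prob A + prob (exceed \<delta> n)" using A exceed_sets by (rule measure_Un_le)
    finally have le: "exp (- c' * rate n) \<le> exp (- (c' + 1) * rate n) + prob (exceed \<delta> n)"
      using elim unfolding A_def B_def by linarith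
    have "2 * exp (- (c' + 1) * rate n) \<le> exp (1 * rate n) * exp (- (c' + 1) * rate n)"
      using elim by (intro mult_right_mono) auto
    also have "\<dots> = exp (- c' * rate n)" by (simp add: algebra_simps flip: exp_add)
    finally have h1: "2 * exp (- (c' + 1) * rate n) \<le> exp (- c' * rate n)" .
    have "2 * exp (- c * rate n) \<le> exp ((c - c') * rate n) * exp (- c * rate n)"
      using elim by (intro mult_right_mono) auto
    also have "\<dots> = exp (- c' * rate n)" by (simp add: algebra_simps flip: exp_add)
    finally show ?case using le h1 by linarith
  qed
qed

lemma exceed_limit:
  assumes \<delta>: "\<delta> > 0"
  shows "(\<lambda>n. ln (prob (exceed \<delta> n)) / rate n) \<longlonglongrightarrow> - (\<delta>\<^sup>2 / 2)"
proof (rule order_tendstoI)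
  have rate_pos: "eventually (\<lambda>n. rate n > 0) sequentially"
    using rate_at_top by (simp add: filterlim_at_top_dense)
  fix a
  show "eventually (\<lambda>n. a < ln (prob (exceed \<delta> n)) / rate n) sequentially" if "a < - (\<delta>\<^sup>2 / 2)"
  proof -
    have "\<delta>\<^sup>2 / 2 < - a" using that by linarith
    from dense[OF this] obtain c where c: "\<delta>\<^sup>2 / 2 < c" "c < - a" by blast
    from exceed_lower[OF \<delta> c(1)] rate_pos show ?thesis
    proof eventually_elim
      case (elim n)
      have "0 < prob (exceed \<delta> n)" using elim(1) by (rule less_le_trans[OF exp_gt_zero])
      then have "- c * rate n \<le> ln (prob (exceed \<delta> n))" using elim(1) by (simp only: ln_ge_iff)
      then have "- c \<le> ln (prob (exceed \<delta> n)) / rate n" using elim(2) by (simp only: pos_le_divide_eq)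
      then show ?case using c by linarith
    qed
  qed
  show "eventually (\<lambda>n. ln (prob (exceed \<delta> n)) / rate n < a) sequentially" if "- (\<delta>\<^sup>2 / 2) < a"
  proof -
    have "- a < \<delta>\<^sup>2 / 2" using that by linarith
    from dense[OF this] obtain c where c: "- a < c" "c < \<delta>\<^sup>2 / 2" by blast
    have "\<delta>\<^sup>2 / 2 < \<delta>\<^sup>2 / 2 + 1" by simp
    \<comment> \<open>\<open>ln\<close> is monotone on positive reals only, so the upper bound also
      needs a positive probability; any exponential lower bound provides it.\<close>
    from exceed_lower[OF \<delta> this] exceed_upper[OF \<delta> c(2)] rate_pos show ?thesis
    proof eventually_elim
      case (elim n)
      have "0 < prob (exceed \<delta> n)" using elim(1) by (rule less_le_trans[OF exp_gt_zero])
      then have "ln (prob (exceed \<delta> n)) \<le> ln (exp (- c * rate n))"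
        using elim(2) by (subst ln_le_cancel_iff) simp_all
      then have "ln (prob (exceed \<delta> n)) / rate n \<le> - c"
        using elim(3) by (simp only: ln_exp pos_divide_le_eq)
      then show ?case using c by linarith
    qed
  qed
qed

text \<open>\<open>rate\<close> eventually exceeds every multiple of ln n, so any positive exponent
  below the critical one, here \<delta>^2 / 4, brings the probabilities below n^-2 and makes them
  summable.\<close>

lemma exceed_eventually_not:
  assumes \<delta>: "\<delta> > 0"
  shows "AE \<omega> in M. eventually (\<lambda>n. \<omega> \<in> space M - exceed \<delta> n) sequentially"
proof (rule borel_cantelli_AE1)
  have c: "0 < \<delta>\<^sup>2 / 4" "\<delta>\<^sup>2 / 4 < \<delta>\<^sup>2 / 2" using \<delta> by auto
  show "summable (\<lambda>n. prob (exceed \<delta> n))"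
  proof (rule summable_comparison_test_ev)
    show "summable (\<lambda>n. 1 / real n ^ 2)"
      using inverse_power_summable[of 2, where 'a=real] by (simp add: inverse_eq_divide)
    show "eventually (\<lambda>n. norm (prob (exceed \<delta> n)) \<le> 1 / real n ^ 2) sequentially"
      using exceed_upper[OF \<delta> c(2)] poly_le_exp_rate[OF c(1), of 1 2] eventually_ge_1
    proof eventually_elim
      case (elim n)
      have "exp (- (\<delta>\<^sup>2 / 4) * rate n) = 1 / exp (\<delta>\<^sup>2 / 4 * rate n)"
        by (simp add: exp_minus inverse_eq_divide)
      also have "\<dots> \<le> 1 / real n ^ 2" using elim by (intro divide_left_mono) auto
      finally show ?case using elim by simp
    qed
  qed
  show "exceed \<delta> n \<in> sets M" for n by (rule exceed_sets)
  show "emeasure M (exceed \<delta> n) < \<infinity>" for n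
    unfolding emeasure_eq_measure by simp
qed

end

theorem theorem4:
  fixes M :: "'w measure"
    and X :: "nat \<Rightarrow> 'w \<Rightarrow> real^'d"
    and f K :: "real^'d \<Rightarrow> real"
    and grad_f :: "real^'d \<Rightarrow> real^'d"
    and hess_f :: "real^'d \<Rightarrow> real^'d^'d"
    and h hs v \<epsilon> :: "nat \<Rightarrow> real"
    and \<delta> :: real
  assumes "prob_space M"
    and X_indep: "prob_space.indep_vars M (\<lambda>_. borel) X {1..}"
    and X_density: "\<And>j. j \<ge> 1 \<Longrightarrow> distributed M lborel (X j) (\<lambda>x. ennreal (f x))"
    and f_nonneg: "\<And>x. f x \<ge> 0"
    and f_bounded: "bounded (range f)"
    and h_pos: "\<And>n. n \<ge> 1 \<Longrightarrow> h n > 0" and h_lim: "h \<longlonglongrightarrow> 0"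
    and hs_pos: "\<And>n. n \<ge> 1 \<Longrightarrow> hs n > 0" and hs_lim: "hs \<longlonglongrightarrow> 0"
    and v_pos: "\<And>n. n \<ge> 1 \<Longrightarrow> v n > 0" and v_lim: "filterlim v at_top sequentially"
    and K_bounded: "bounded (range K)"
    and K_nonneg: "\<And>z. K z \<ge> 0"
    and K_vanish: "(K \<longlongrightarrow> 0) at_infinity"
    and K_integrable: "integrable lborel K"
    and K_integral: "(\<integral>z. K z \<partial>lborel) = 1"
    and K_centered: "\<And>j. (\<integral>z. z $ j * K z \<partial>lborel) = 0"
    and K_moment2: "integrable lborel (\<lambda>z. (norm z)\<^sup>2 * \<bar>K z\<bar>)"
    and K_holder: "holder_continuous K"
    and K_covering: "covering_number_condition K"
    and f_grad: "\<And>x. GDERIV f x :> grad_f x"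
    and f_hess: "\<And>x. (grad_f has_derivative (\<lambda>u. hess_f x *v u)) (at x)"
    and grad_bounded: "bdd_above (range (\<lambda>x. norm (grad_f x)))"
    and hess_bounded: "bdd_above (range (\<lambda>x. onorm (\<lambda>u. hess_f x *v u)))"
    and f_tail: "\<exists>q>0. bounded (range (\<lambda>z. norm z powr q * f z))"
    and eps_pos: "\<And>n. n \<ge> 1 \<Longrightarrow> \<epsilon> n > 0"
    and eps_lim: "\<epsilon> \<longlonglongrightarrow> 0"
    and "(\<lambda>n. hs n / \<epsilon> n) \<longlonglongrightarrow> 0"
    and "(\<lambda>n. (h n)\<^sup>2 / \<epsilon> n) \<longlonglongrightarrow> 0"
    and "filterlim (\<lambda>n. v n * \<epsilon> n powr (3/2)) at_top sequentially"
    and "(\<lambda>n. v n * (hs n)\<^sup>2 / sqrt (\<epsilon> n)) \<longlonglongrightarrow> 0"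
    and "filterlim (\<lambda>n. real n * hs n ^ CARD('d) / ((v n)\<^sup>2 * ln (1 / hs n))) at_top sequentially"
    and "filterlim (\<lambda>n. (v n)\<^sup>2 * h n ^ CARD('d) * (\<epsilon> n)\<^sup>2 / hs n ^ CARD('d)) at_top sequentially"
    and "\<delta> > 0"
  shows
    "(\<lambda>n. (v n)\<^sup>2 / (real n * hs n ^ CARD('d)) *
        ln (measure M {\<omega> \<in> space M. \<exists>x. f x \<notin>
              {kde K X n (hs n) \<omega> x - \<delta> * sqrt (trunc_kde K X n (h n) (\<epsilon> n) \<omega> x * kappa K) / v n ..
               kde K X n (hs n) \<omega> x + \<delta> * sqrt (trunc_kde K X n (h n) (\<epsilon> n) \<omega> x * kappa K) / v n}}))
       \<longlonglongrightarrow> - (\<delta>\<^sup>2 / 2) \<and>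
     asymptotic_as_confidence_regions M
       (\<lambda>n \<omega>. {g. \<forall>x. \<bar>g x - kde K X n (hs n) \<omega> x\<bar>
                 \<le> \<delta> * sqrt (trunc_kde K X n (h n) (\<epsilon> n) \<omega> x * kappa K) / v n}) f"
proof -
  interpret prob_space M by fact
  obtain fmax where fmax: "\<And>x. \<bar>f x\<bar> \<le> fmax"
    using f_bounded unfolding bounded_iff by auto
  obtain Kmax where Kmax: "\<And>x. \<bar>K x\<bar> \<le> Kmax"
    using K_bounded unfolding bounded_iff by auto
  obtain G where G: "\<And>x. norm (grad_f x) \<le> G"
    using grad_bounded unfolding bdd_above_def by auto
  obtain H where H: "\<And>x. onorm (\<lambda>u. hess_f x *v u) \<le> H"
    using hess_bounded unfolding bdd_above_def by auto
  obtain \<alpha> L where \<alpha>: "0 < \<alpha>" and L: "\<And>x y. \<bar>K x - K y\<bar> \<le> L * norm (x - y) powr \<alpha>"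
    using K_holder unfolding holder_continuous_def by blast
  \<comment> \<open>The Hoelder constant comes without a sign; its absolute value satisfies the same
    inequality and is nonnegative.\<close>
  interpret kde_asymptotics M X f K grad_f G H fmax Kmax "\<bar>L\<bar>" \<alpha> h hs v \<epsilon>
  proof unfold_locales
    show "indep_vars (\<lambda>_. borel) X {1..}" by (rule X_indep)
    show "distributed M lborel (X j) (\<lambda>x. ennreal (f x))" if "j \<ge> 1" for j by (rule X_density[OF that])
    show "f x \<le> fmax" "K x \<le> Kmax" for x using fmax[of x] Kmax[of x] by auto
    show "\<bar>f x - f y\<bar> \<le> G * norm (x - y)" for x y by (rule gradient_lipschitz[OF f_grad G])
    show "\<bar>f (x + w) - f x - grad_f x \<bullet> w\<bar> \<le> H * (norm w)\<^sup>2" for x w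
      by (rule gradient_linearization[OF f_grad f_hess H])
    show "integrable lborel (\<lambda>z. (norm z)\<^sup>2 * K z)" using K_moment2 K_nonneg by simp
    show "\<bar>K x - K y\<bar> \<le> \<bar>L\<bar> * norm (x - y) powr \<alpha>" for x y
      by (rule order_trans[OF L mult_right_mono[OF abs_ge_self]]) simp
    show "0 \<le> G" using G norm_ge_zero order_trans by blast
    show "0 \<le> H" using H onorm_pos_le[OF has_derivative_bounded_linear[OF f_hess]] order_trans by blast
  qed (use assms \<alpha> in auto)
  have event: "{\<omega> \<in> space M. \<exists>x. f x \<notin>
              {kde K X n (hs n) \<omega> x - \<delta> * sqrt (trunc_kde K X n (h n) (\<epsilon> n) \<omega> x * kappa K) / v n ..
               kde K X n (hs n) \<omega> x + \<delta> * sqrt (trunc_kde K X n (h n) (\<epsilon> n) \<omega> x * kappa K) / v n}}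
      = exceed \<delta> n" for n
    unfolding exceed_def atLeastAtMost_iff
    by (intro Collect_cong conj_cong refl ex_cong1) (auto simp: not_le abs_real_def)
  have lim: "(\<lambda>n. (v n)\<^sup>2 / (real n * hs n ^ CARD('d)) * ln (prob (exceed \<delta> n))) \<longlonglongrightarrow> - (\<delta>\<^sup>2 / 2)"
    using exceed_limit[OF \<open>\<delta> > 0\<close>] by (simp add: rate_def mult.commute)
  \<comment> \<open>The exceptional set is enclosed in a measurable null set, whose complement is
    the required set of full probability.\<close>
  obtain N where N: "{\<omega> \<in> space M. \<not> (\<forall>\<^sub>F n in sequentially. \<omega> \<in> space M - exceed \<delta> n)} \<subseteq> N"
      "emeasure M N = 0" "N \<in> sets M"
    using AE_E[OF exceed_eventually_not[OF \<open>\<delta> > 0\<close>]] .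
  have "asymptotic_as_confidence_regions M
       (\<lambda>n \<omega>. {g. \<forall>x. \<bar>g x - kde K X n (hs n) \<omega> x\<bar>
                 \<le> \<delta> * sqrt (trunc_kde K X n (h n) (\<epsilon> n) \<omega> x * kappa K) / v n}) f"
    unfolding asymptotic_as_confidence_regions_def
  proof (intro bexI conjI ballI)
    show "space M - N \<in> sets M" using N by auto
    have "prob N = 0" using N(2) by (simp add: measure_def)
    then show "prob (space M - N) = 1" using prob_compl[OF N(3)] by simp
    fix \<omega> assume \<omega>: "\<omega> \<in> space M - N"
    then have "\<forall>\<^sub>F n in sequentially. \<omega> \<in> space M - exceed \<delta> n" using N(1) by blast
    then obtain n0 where "\<And>n. n \<ge> n0 \<Longrightarrow> \<omega> \<notin> exceed \<delta> n"
      unfolding eventually_sequentially by auto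
    then show "\<exists>N. \<forall>n\<ge>N. f \<in> {g. \<forall>x. \<bar>g x - kde K X n (hs n) \<omega> x\<bar>
                 \<le> \<delta> * sqrt (trunc_kde K X n (h n) (\<epsilon> n) \<omega> x * kappa K) / v n}"
      using \<omega> by (intro exI[of _ n0]) (auto simp: exceed_def not_less)
  qed
  with lim show ?thesis unfolding event by blast
qed

end
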